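(* Let $P$ be a countable discrete semigroup with identity and let $E$ be a product system over $P$ of finite-dimensional Hilbert spaces. There is a pair $(\mathcal{O}_E,i_E)$ consisting of a $C^*$-algebra $\mathcal{O}_E$ and a Cuntz representation $i_E:E\to\mathcal{O}_E$ with the following properties: (a) for every Cuntz representation $\phi:E\to B$ of $E$ in a $C^*$-algebra $B$, there is a $*$-homomorphism $\phi_*:\mathcal{O}_E\to B$ such that $\phi_*\circ i_E=\phi$; and (b) $\mathcal{O}_E$ is generated as a $C^*$-algebra by $i_E(E)$. The pair $(\mathcal{O}_E,i_E)$ is unique up to canonical isomorphism: if $(A,j)$ is another pair consisting of a $C^*$-algebra and a Cuntz representation with these two properties, then there is an isomorphism $\theta:\mathcal{O}_E\to A$ with $\theta\circ i_E=j$.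
   Context: Let $P$ be a countable discrete semigroup with identity $e$. A product system over $P$ is a family $p:E\to P$ of nontrivial separable complex Hilbert spaces $E_t:=p^{-1}(t)$ endowed with an associative multiplication $E\times E\to E$ such that $p$ is a semigroup homomorphism and such that for all $s,t\in P$ the map $x\otimes y\in E_s\otimes E_t\mapsto xy\in E_{st}$ extends to a unitary isomorphism; one also requires $\dim E_e=1$, so that $E$ has an identity element $1\in E_e$. Inner products are linear in the first variable. A representation of $E$ in a $C^*$-algebra $B$ is a map $\phi:E\to B$ with (i) $\phi(xy)=\phi(x)\phi(y)$ for all $x,y\in E$, and (ii) $\phi(y)^*\phi(x)=(x\mid y)\phi(1)$ whenever $p(x)=p(y)$. When all fibers $E_t$ are finite-dimensional, $\phi$ is a Cuntz representation if moreover for every $t\in P$ and every orthonormal basis $\mathcal{B}_t$ of $E_t$, $\sum_{f\in\mathcal{B}_t}\phi(f)\phi(f)^*=\phi(1)$. The zero map is allowed as a (trivial) Cuntz representation, and $\mathcal{O}_E=\{0\}$ is allowed. *)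

theory Defs
  imports
    "HOL-Algebra.Algebraic_Closure_Type"
    "HOL-Analysis.Analysis"
begin

section \<open>Complex vector spaces and Hilbert spaces on carrier sets\<close>

abbreviation complex_ring :: "complex ring"
  where "complex_ring \<equiv> ring_of_type_algebra"

text \<open>
  Vector spaces are modules over the field of complex numbers. The record type of modules extends
  that of rings, so it also has fields for a product and for a unit. The locale of modules says
  nothing about them: for Hilbert spaces both are ignored, for C*-algebras (which need not be
  unital) only the unit is ignored.
\<close>

abbreviation complex_vector_space :: "(complex, 'a, 'm) module_scheme \<Rightarrow> bool"
  where "complex_vector_space V \<equiv> Module.module complex_ring V"

definition lin_span :: "(complex, 'a, 'm) module_scheme \<Rightarrow> 'a set \<Rightarrow> 'a set"
  where "lin_span V S =
    {finsum V (\<lambda>v. c v \<odot>\<^bsub>V\<^esub> v) F |F c. finite F \<and> F \<subseteq> S}"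

definition fin_dim :: "(complex, 'a, 'm) module_scheme \<Rightarrow> bool"
  where "fin_dim V \<longleftrightarrow> (\<exists>S. finite S \<and> S \<subseteq> carrier V \<and> lin_span V S = carrier V)"

definition one_dim :: "(complex, 'a, 'm) module_scheme \<Rightarrow> bool"
  where "one_dim V \<longleftrightarrow>
    (\<exists>u \<in> carrier V. u \<noteq> \<zero>\<^bsub>V\<^esub> \<and> carrier V = {a \<odot>\<^bsub>V\<^esub> u |a. True})"

text \<open>
  The locale \<^locale>\<open>Metric_space\<close> wants a distance that is symmetric and nonnegative also outside
  the carrier, hence the default value.
\<close>

definition norm_dist :: "(complex, 'a, 'm) module_scheme \<Rightarrow> ('a \<Rightarrow> real) \<Rightarrow> 'a \<Rightarrow> 'a \<Rightarrow> real"
  where "norm_dist V n x y =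
    (if x \<in> carrier V \<and> y \<in> carrier V then n (x \<ominus>\<^bsub>V\<^esub> y) else 0)"

definition norm_topology :: "(complex, 'a, 'm) module_scheme \<Rightarrow> ('a \<Rightarrow> real) \<Rightarrow> 'a topology"
  where "norm_topology V n = Metric_space.mtopology (carrier V) (norm_dist V n)"

definition norm_complete :: "(complex, 'a, 'm) module_scheme \<Rightarrow> ('a \<Rightarrow> real) \<Rightarrow> bool"
  where "norm_complete V n \<longleftrightarrow> Metric_space.mcomplete (carrier V) (norm_dist V n)"

record 'a hilbert_space = "(complex, 'a) module" +
  ip :: "'a \<Rightarrow> 'a \<Rightarrow> complex"

definition ip_norm :: "'a hilbert_space \<Rightarrow> 'a \<Rightarrow> real"
  where "ip_norm H x = sqrt (Re (ip H x x))"

locale hilbert_space =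
  fixes H :: "'a hilbert_space" (structure)
  assumes vector_space: "complex_vector_space H"
    and ip_add_left: "\<lbrakk>x \<in> carrier H; y \<in> carrier H; z \<in> carrier H\<rbrakk>
      \<Longrightarrow> ip H (x \<oplus> y) z = ip H x z + ip H y z"
    and ip_smult_left: "\<lbrakk>x \<in> carrier H; y \<in> carrier H\<rbrakk> \<Longrightarrow> ip H (a \<odot> x) y = a * ip H x y"
    and ip_cnj: "\<lbrakk>x \<in> carrier H; y \<in> carrier H\<rbrakk> \<Longrightarrow> ip H y x = cnj (ip H x y)"
    and ip_nonneg: "x \<in> carrier H \<Longrightarrow> 0 \<le> Re (ip H x x)"
    and ip_definite: "\<lbrakk>x \<in> carrier H; ip H x x = 0\<rbrakk> \<Longrightarrow> x = \<zero>"
    and complete: "norm_complete H (ip_norm H)"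

abbreviation hilbert_topology :: "'a hilbert_space \<Rightarrow> 'a topology"
  where "hilbert_topology H \<equiv> norm_topology H (ip_norm H)"

definition total_set :: "'a hilbert_space \<Rightarrow> 'a set \<Rightarrow> bool"
  where "total_set H S \<longleftrightarrow> hilbert_topology H closure_of (lin_span H S) = carrier H"

definition orthonormal_basis :: "'a hilbert_space \<Rightarrow> 'a set \<Rightarrow> bool"
  where "orthonormal_basis H B \<longleftrightarrow>
    B \<subseteq> carrier H \<and> (\<forall>x\<in>B. \<forall>y\<in>B. ip H x y = (if x = y then 1 else 0)) \<and> total_set H B"

text \<open>
  The map \<open>x \<otimes> y \<mapsto> m x y\<close> extends to a unitary from the Hilbert space tensor product of \<open>H\<close> and
  \<open>K\<close> onto \<open>L\<close>. The tensor product is the completion of the algebraic one for the inner product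
  determined by \<open>(x \<otimes> y | x' \<otimes> y') = (x | x') (y | y')\<close>. So \<open>m\<close> has to be bilinear (to be defined
  on the algebraic tensor product), to preserve these inner products (to extend to an isometry),
  and to have products that span a dense subspace (for this isometry to be onto).
\<close>

locale tensor_unitary =
  fixes H K L :: "'a hilbert_space" and m :: "'a \<Rightarrow> 'a \<Rightarrow> 'a"
  assumes closed: "\<lbrakk>x \<in> carrier H; y \<in> carrier K\<rbrakk> \<Longrightarrow> m x y \<in> carrier L"
    and add_left: "\<lbrakk>x \<in> carrier H; x' \<in> carrier H; y \<in> carrier K\<rbrakk>
      \<Longrightarrow> m (x \<oplus>\<^bsub>H\<^esub> x') y = m x y \<oplus>\<^bsub>L\<^esub> m x' y"
    and add_right: "\<lbrakk>x \<in> carrier H; y \<in> carrier K; y' \<in> carrier K\<rbrakk>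
      \<Longrightarrow> m x (y \<oplus>\<^bsub>K\<^esub> y') = m x y \<oplus>\<^bsub>L\<^esub> m x y'"
    and smult_left: "\<lbrakk>x \<in> carrier H; y \<in> carrier K\<rbrakk>
      \<Longrightarrow> m (a \<odot>\<^bsub>H\<^esub> x) y = a \<odot>\<^bsub>L\<^esub> m x y"
    and smult_right: "\<lbrakk>x \<in> carrier H; y \<in> carrier K\<rbrakk>
      \<Longrightarrow> m x (a \<odot>\<^bsub>K\<^esub> y) = a \<odot>\<^bsub>L\<^esub> m x y"
    and isometric: "\<lbrakk>x \<in> carrier H; x' \<in> carrier H; y \<in> carrier K; y' \<in> carrier K\<rbrakk>
      \<Longrightarrow> ip L (m x y) (m x' y') = ip H x x' * ip K y y'"
    and onto: "total_set L {m x y |x y. x \<in> carrier H \<and> y \<in> carrier K}"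


section \<open>C*-algebras\<close>

record 'a cstar_algebra = "(complex, 'a) module" +
  star :: "'a \<Rightarrow> 'a"
  cnorm :: "'a \<Rightarrow> real"

locale cstar_algebra =
  fixes A :: "'a cstar_algebra" (structure)
  assumes vector_space: "complex_vector_space A"
    and mult_closed: "\<lbrakk>x \<in> carrier A; y \<in> carrier A\<rbrakk> \<Longrightarrow> x \<otimes> y \<in> carrier A"
    and mult_assoc: "\<lbrakk>x \<in> carrier A; y \<in> carrier A; z \<in> carrier A\<rbrakk>
      \<Longrightarrow> (x \<otimes> y) \<otimes> z = x \<otimes> (y \<otimes> z)"
    and distrib_right: "\<lbrakk>x \<in> carrier A; y \<in> carrier A; z \<in> carrier A\<rbrakk>
      \<Longrightarrow> (x \<oplus> y) \<otimes> z = (x \<otimes> z) \<oplus> (y \<otimes> z)"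
    and distrib_left: "\<lbrakk>x \<in> carrier A; y \<in> carrier A; z \<in> carrier A\<rbrakk>
      \<Longrightarrow> z \<otimes> (x \<oplus> y) = (z \<otimes> x) \<oplus> (z \<otimes> y)"
    and smult_mult_left: "\<lbrakk>x \<in> carrier A; y \<in> carrier A\<rbrakk>
      \<Longrightarrow> (a \<odot> x) \<otimes> y = a \<odot> (x \<otimes> y)"
    and smult_mult_right: "\<lbrakk>x \<in> carrier A; y \<in> carrier A\<rbrakk>
      \<Longrightarrow> x \<otimes> (a \<odot> y) = a \<odot> (x \<otimes> y)"
    and star_closed: "x \<in> carrier A \<Longrightarrow> star A x \<in> carrier A"
    and star_star: "x \<in> carrier A \<Longrightarrow> star A (star A x) = x"
    and star_add: "\<lbrakk>x \<in> carrier A; y \<in> carrier A\<rbrakk>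
      \<Longrightarrow> star A (x \<oplus> y) = star A x \<oplus> star A y"
    and star_smult: "x \<in> carrier A \<Longrightarrow> star A (a \<odot> x) = cnj a \<odot> star A x"
    and star_mult: "\<lbrakk>x \<in> carrier A; y \<in> carrier A\<rbrakk>
      \<Longrightarrow> star A (x \<otimes> y) = star A y \<otimes> star A x"
    and cnorm_nonneg: "x \<in> carrier A \<Longrightarrow> 0 \<le> cnorm A x"
    and cnorm_eq_0: "x \<in> carrier A \<Longrightarrow> cnorm A x = 0 \<longleftrightarrow> x = \<zero>"
    and cnorm_triangle: "\<lbrakk>x \<in> carrier A; y \<in> carrier A\<rbrakk>
      \<Longrightarrow> cnorm A (x \<oplus> y) \<le> cnorm A x + cnorm A y"
    and cnorm_smult: "x \<in> carrier A \<Longrightarrow> cnorm A (a \<odot> x) = cmod a * cnorm A x"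
    and cnorm_mult: "\<lbrakk>x \<in> carrier A; y \<in> carrier A\<rbrakk>
      \<Longrightarrow> cnorm A (x \<otimes> y) \<le> cnorm A x * cnorm A y"
    and cstar_identity: "x \<in> carrier A \<Longrightarrow> cnorm A (star A x \<otimes> x) = (cnorm A x)\<^sup>2"
    and complete: "norm_complete A (cnorm A)"

definition cstar_subalgebra :: "'a cstar_algebra \<Rightarrow> 'a set \<Rightarrow> bool"
  where "cstar_subalgebra A T \<longleftrightarrow>
    T \<subseteq> carrier A \<and> \<zero>\<^bsub>A\<^esub> \<in> T \<and>
    (\<forall>x\<in>T. \<forall>y\<in>T. x \<oplus>\<^bsub>A\<^esub> y \<in> T \<and> x \<otimes>\<^bsub>A\<^esub> y \<in> T) \<and>
    (\<forall>x\<in>T. star A x \<in> T \<and> (\<forall>a. a \<odot>\<^bsub>A\<^esub> x \<in> T)) \<and>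
    closedin (norm_topology A (cnorm A)) T"

definition cstar_generated :: "'a cstar_algebra \<Rightarrow> 'a set \<Rightarrow> 'a set"
  where "cstar_generated A S = \<Inter> {T. cstar_subalgebra A T \<and> S \<subseteq> T}"

definition star_hom :: "'a cstar_algebra \<Rightarrow> 'b cstar_algebra \<Rightarrow> ('a \<Rightarrow> 'b) \<Rightarrow> bool"
  where "star_hom A B h \<longleftrightarrow>
    h \<in> carrier A \<rightarrow> carrier B \<and>
    (\<forall>x\<in>carrier A. \<forall>y\<in>carrier A.
      h (x \<oplus>\<^bsub>A\<^esub> y) = h x \<oplus>\<^bsub>B\<^esub> h y \<and> h (x \<otimes>\<^bsub>A\<^esub> y) = h x \<otimes>\<^bsub>B\<^esub> h y) \<and>
    (\<forall>x\<in>carrier A. h (star A x) = star B (h x) \<and> (\<forall>a. h (a \<odot>\<^bsub>A\<^esub> x) = a \<odot>\<^bsub>B\<^esub> h x))"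

definition star_iso :: "'a cstar_algebra \<Rightarrow> 'b cstar_algebra \<Rightarrow> ('a \<Rightarrow> 'b) \<Rightarrow> bool"
  where "star_iso A B h \<longleftrightarrow> star_hom A B h \<and> bij_betw h (carrier A) (carrier B)"


section \<open>Product systems and their representations\<close>

text \<open>
  \<open>H t\<close> is the fibre over \<open>t\<close> with its Hilbert space structure. The unit \<open>\<one>\<^bsub>E\<^esub>\<close> lies in the fibre
  over \<open>\<one>\<^bsub>P\<^esub>\<close>: \<open>p \<one>\<^bsub>E\<^esub>\<close> is neutral for the range of \<open>p\<close>, which is all of \<open>P\<close> because no fibre is
  empty.
\<close>

locale product_system =
  fixes P :: "'p monoid" and E :: "'e monoid" and p :: "'e \<Rightarrow> 'p"
    and H :: "'p \<Rightarrow> 'e hilbert_space"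
  assumes monoid_P: "Group.monoid P"
    and countable_P: "countable (carrier P)"
    and monoid_E: "Group.monoid E"
    and hom_p: "p \<in> hom E P"
    and carrier_fibre: "t \<in> carrier P \<Longrightarrow> carrier (H t) = {x \<in> carrier E. p x = t}"
    and hilbert_fibre: "t \<in> carrier P \<Longrightarrow> hilbert_space (H t)"
    and separable_fibre: "t \<in> carrier P \<Longrightarrow> separable_space (hilbert_topology (H t))"
    and nontrivial_fibre: "t \<in> carrier P \<Longrightarrow> carrier (H t) \<noteq> {\<zero>\<^bsub>H t\<^esub>}"
    and tensor_fibres: "\<lbrakk>s \<in> carrier P; t \<in> carrier P\<rbrakk>
      \<Longrightarrow> tensor_unitary (H s) (H t) (H (s \<otimes>\<^bsub>P\<^esub> t)) (\<lambda>x y. x \<otimes>\<^bsub>E\<^esub> y)"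
    and one_dim_fibre: "one_dim (H \<one>\<^bsub>P\<^esub>)"

locale fin_dim_product_system = product_system +
  assumes fin_dim_fibre: "t \<in> carrier P \<Longrightarrow> fin_dim (H t)"

definition representation ::
  "'e monoid \<Rightarrow> ('e \<Rightarrow> 'p) \<Rightarrow> ('p \<Rightarrow> 'e hilbert_space) \<Rightarrow> 'b cstar_algebra \<Rightarrow> ('e \<Rightarrow> 'b) \<Rightarrow> bool"
  where "representation E p H B \<phi> \<longleftrightarrow>
    \<phi> \<in> carrier E \<rightarrow> carrier B \<and>
    (\<forall>x\<in>carrier E. \<forall>y\<in>carrier E. \<phi> (x \<otimes>\<^bsub>E\<^esub> y) = \<phi> x \<otimes>\<^bsub>B\<^esub> \<phi> y) \<and>
    (\<forall>x\<in>carrier E. \<forall>y\<in>carrier E. p x = p y \<longrightarrow>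
      star B (\<phi> y) \<otimes>\<^bsub>B\<^esub> \<phi> x = ip (H (p x)) x y \<odot>\<^bsub>B\<^esub> \<phi> \<one>\<^bsub>E\<^esub>)"

text \<open>To be used when the fibres are finite-dimensional, so that their orthonormal bases are finite.\<close>

definition cuntz_representation ::
  "'p monoid \<Rightarrow> 'e monoid \<Rightarrow> ('e \<Rightarrow> 'p) \<Rightarrow> ('p \<Rightarrow> 'e hilbert_space)
    \<Rightarrow> 'b cstar_algebra \<Rightarrow> ('e \<Rightarrow> 'b) \<Rightarrow> bool"
  where "cuntz_representation P E p H B \<phi> \<longleftrightarrow>
    representation E p H B \<phi> \<and>
    (\<forall>t\<in>carrier P. \<forall>F. orthonormal_basis (H t) F \<longrightarrow>
      finsum B (\<lambda>f. \<phi> f \<otimes>\<^bsub>B\<^esub> star B (\<phi> f)) F = \<phi> \<one>\<^bsub>E\<^esub>)"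

text \<open>
  The universal property with respect to the C*-algebras whose elements are taken from the
  type \<open>'b\<close>. A formula cannot quantify over types, so as a conclusion this is to be used with \<open>'b\<close>
  a type variable; as a hypothesis it may be used at any one type, which only makes it weaker.
\<close>

definition cuntz_universal ::
  "'b itself \<Rightarrow> 'p monoid \<Rightarrow> 'e monoid \<Rightarrow> ('e \<Rightarrow> 'p) \<Rightarrow> ('p \<Rightarrow> 'e hilbert_space)
    \<Rightarrow> 'a cstar_algebra \<Rightarrow> ('e \<Rightarrow> 'a) \<Rightarrow> bool"
  where "cuntz_universal _ P E p H A i \<longleftrightarrow>
    (\<forall>(B :: 'b cstar_algebra) \<phi>.
      cstar_algebra B \<longrightarrow> cuntz_representation P E p H B \<phi> \<longrightarrow>
      (\<exists>h. star_hom A B h \<and> (\<forall>x\<in>carrier E. h (i x) = \<phi> x)))"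

text \<open>
  Up to isomorphism, every C*-algebra generated by the image of \<open>E\<close> under a map has its elements
  in the type below: an element is the limit of a sequence of finite sums of words in the images
  of elements of \<open>E\<close> (tag \<^term>\<open>False\<close>) and their adjoints (tag \<^term>\<open>True\<close>); scalars are not needed
  when the map is a representation, which is linear on fibres.
\<close>

type_synonym 'e code = "nat \<Rightarrow> ('e \<times> bool) list list"

text \<open>
  The pair is a closed term, so it cannot depend on the type of the C*-algebra against which
  its universal property is tested. That the choice succeeds has to be proved.
\<close>

definition cuntz_pair ::
  "'p monoid \<Rightarrow> 'e monoid \<Rightarrow> ('e \<Rightarrow> 'p) \<Rightarrow> ('p \<Rightarrow> 'e hilbert_space)
    \<Rightarrow> 'e code cstar_algebra \<times> ('e \<Rightarrow> 'e code)"
  where "cuntz_pair P E p H = (SOME (A, i).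
    cstar_algebra A \<and> cuntz_representation P E p H A i \<and>
    cuntz_universal TYPE('e code) P E p H A i \<and>
    cstar_generated A (i ` carrier E) = carrier A)"

definition cuntz_algebra ::
  "'p monoid \<Rightarrow> 'e monoid \<Rightarrow> ('e \<Rightarrow> 'p) \<Rightarrow> ('p \<Rightarrow> 'e hilbert_space) \<Rightarrow> 'e code cstar_algebra"
  where "cuntz_algebra P E p H = fst (cuntz_pair P E p H)"

definition cuntz_map ::
  "'p monoid \<Rightarrow> 'e monoid \<Rightarrow> ('e \<Rightarrow> 'p) \<Rightarrow> ('p \<Rightarrow> 'e hilbert_space) \<Rightarrow> 'e \<Rightarrow> 'e code"
  where "cuntz_map P E p H = snd (cuntz_pair P E p H)"

end

theory Submission
  imports Defs
begin

text \<open>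
  Representations satisfy \<open>\<parallel>\<phi>(x)\<parallel>\<^sup>2 \<le> (x | x)\<close>, so all the Cuntz representations whose C*-algebras live
  on one fixed type combine into a single one, in the bounded product of these algebras; the
  C*-algebra that it generates is universal for them, by the coordinate projections. Every
  algebra generated by a Cuntz representation is the closure of the sums of words in the \<open>\<phi>(x)\<close> and
  \<open>\<phi>(x)\<^sup>*\<close>, hence embeds as a set into \<^typ>\<open>'e code\<close>. So that type can serve as the fixed one, and
  universality for it implies universality for every other type.

  Uniqueness needs *-homomorphisms to be continuous, so that they are determined by their values on
  generators. If \<open>a\<close> is self-adjoint of norm at most \<open>1/2\<close>, a fixed point iteration gives a
  self-adjoint \<open>y\<close> that commutes with \<open>a\<close> and satisfies \<open>(1 - y)\<^sup>2 = 1 - a\<^sup>2\<close>. The image of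
  \<open>a + i(1 - y)\<close> under a *-homomorphism \<open>h\<close> is then formally unitary and has \<open>h(a)\<close> as its real part,
  so \<open>\<parallel>h(a)\<parallel> \<le> 1\<close>. This avoids the spectral radius.
\<close>

section \<open>Normed spaces on carrier sets\<close>

lemma complex_ring_simps [simp]:
  "carrier complex_ring = UNIV" "a \<oplus>\<^bsub>complex_ring\<^esub> b = a + b" "a \<otimes>\<^bsub>complex_ring\<^esub> b = a * b"
  "\<one>\<^bsub>complex_ring\<^esub> = 1" "\<zero>\<^bsub>complex_ring\<^esub> = 0"
  by (simp_all add: ring_of_type_algebra_def)

text \<open>Negation is not a record field but the inverse in the additive group, so it is found by
  uniqueness of inverses.\<close>

lemma complex_ring_uminus [simp]: "\<ominus>\<^bsub>complex_ring\<^esub> a = - a"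
proof -
  interpret cring complex_ring by (rule cring_from_type_algebra)
  show ?thesis by (rule minus_equality) auto
qed

text \<open>The law \<open>0 \<odot> x = \<zero>\<close> supplies additive inverses:
  \<open>(-1) \<odot> x \<oplus> x\<close> equals \<open>0 \<odot> x\<close> by
  distributivity.\<close>

lemma complex_vector_spaceI:
  fixes V (structure)
  assumes "\<And>x y. x \<in> carrier V \<Longrightarrow> y \<in> carrier V \<Longrightarrow> x \<oplus> y \<in> carrier V"
    and "\<zero> \<in> carrier V"
    and "\<And>x y z. x \<in> carrier V \<Longrightarrow> y \<in> carrier V \<Longrightarrow> z \<in> carrier V \<Longrightarrow> (x \<oplus> y) \<oplus> z = x \<oplus> (y \<oplus> z)"
    and "\<And>x y. x \<in> carrier V \<Longrightarrow> y \<in> carrier V \<Longrightarrow> x \<oplus> y = y \<oplus> x"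
    and "\<And>x. x \<in> carrier V \<Longrightarrow> \<zero> \<oplus> x = x"
    and smult: "\<And>a x. x \<in> carrier V \<Longrightarrow> a \<odot> x \<in> carrier V"
    and l_distr: "\<And>a b x. x \<in> carrier V \<Longrightarrow> (a + b) \<odot> x = a \<odot> x \<oplus> b \<odot> x"
    and "\<And>a x y. x \<in> carrier V \<Longrightarrow> y \<in> carrier V \<Longrightarrow> a \<odot> (x \<oplus> y) = a \<odot> x \<oplus> a \<odot> y"
    and "\<And>a b x. x \<in> carrier V \<Longrightarrow> (a * b) \<odot> x = a \<odot> (b \<odot> x)"
    and one: "\<And>x. x \<in> carrier V \<Longrightarrow> 1 \<odot> x = x"
    and null: "\<And>x. x \<in> carrier V \<Longrightarrow> 0 \<odot> x = \<zero>"
  shows "complex_vector_space V"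
proof (rule moduleI)
  have neg: "(-1) \<odot> x \<oplus> x = \<zero>" if "x \<in> carrier V" for x
    using l_distr[OF that, of "-1" 1] one[OF that] null[OF that] by simp
  show "abelian_group V"
  proof (rule abelian_groupI)
    show "\<exists>y\<in>carrier V. y \<oplus> x = \<zero>" if "x \<in> carrier V" for x
      using neg smult that by blast
  qed (fact assms)+
qed (simp_all add: assms cring_from_type_algebra)

text \<open>Since \<open>n\<close> is unconstrained outside the carrier, membership of all terms and
  of the limit is built in. For sequences in the carrier this is the limit in the norm
  topology.\<close>

definition tends :: "(complex, 'a, 'm) module_scheme \<Rightarrow> ('a \<Rightarrow> real) \<Rightarrow> (nat \<Rightarrow> 'a) \<Rightarrow> 'a \<Rightarrow> bool"
  where "tends V n f x \<longleftrightarrow> range f \<subseteq> carrier V \<and> x \<in> carrier V \<and> (\<lambda>k. n (f k \<ominus>\<^bsub>V\<^esub> x)) \<longlonglongrightarrow> 0"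

locale complex_vs =
  fixes V :: "(complex, 'a, 'm) module_scheme" (structure)
  assumes vs: "complex_vector_space V"
begin

sublocale module complex_ring V
  by (rule vs)

lemma smult_carrier [simp, intro]: "x \<in> carrier V \<Longrightarrow> a \<odot> x \<in> carrier V"
  by (rule smult_closed) auto

lemma smult_add_left: "x \<in> carrier V \<Longrightarrow> (a + b) \<odot> x = a \<odot> x \<oplus> b \<odot> x"
  using smult_l_distr[of a b x] by simp

lemma smult_add_right: "x \<in> carrier V \<Longrightarrow> y \<in> carrier V \<Longrightarrow> a \<odot> (x \<oplus> y) = a \<odot> x \<oplus> a \<odot> y"
  using smult_r_distr[of a x y] by simp

lemma smult_smult: "x \<in> carrier V \<Longrightarrow> a \<odot> (b \<odot> x) = (a * b) \<odot> x"
  using smult_assoc1[of a b x] by simp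

lemma smult_1 [simp]: "x \<in> carrier V \<Longrightarrow> 1 \<odot> x = x"
  using smult_one[of x] by simp

lemma smult_0 [simp]: "x \<in> carrier V \<Longrightarrow> 0 \<odot> x = \<zero>"
  using smult_l_null[of x] by simp

lemma smult_zero [simp]: "a \<odot> \<zero> = \<zero>"
  using smult_r_null[of a] by simp

lemma uminus_conv: "x \<in> carrier V \<Longrightarrow> \<ominus> x = (-1) \<odot> x"
  using smult_l_minus[of 1 x] by simp

lemma minus_conv: "x \<in> carrier V \<Longrightarrow> y \<in> carrier V \<Longrightarrow> x \<ominus> y = x \<oplus> (-1) \<odot> y"
  by (simp add: M.minus_eq uminus_conv)

lemma minus_eq_zero: "x \<in> carrier V \<Longrightarrow> y \<in> carrier V \<Longrightarrow> x \<ominus> y = \<zero> \<longleftrightarrow> x = y"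
  by (metis M.add.inv_closed M.add.inv_equality M.add.inv_inv M.minus_eq M.r_neg)

lemma add_diff_add:
  "\<lbrakk>x \<in> carrier V; y \<in> carrier V; x' \<in> carrier V; y' \<in> carrier V\<rbrakk>
    \<Longrightarrow> (x \<oplus> y) \<ominus> (x' \<oplus> y') = (x \<ominus> x') \<oplus> (y \<ominus> y')"
  by (simp add: minus_conv smult_add_right M.add.m_ac)

lemma smult_diff:
  "x \<in> carrier V \<Longrightarrow> y \<in> carrier V \<Longrightarrow> a \<odot> (x \<ominus> y) = a \<odot> x \<ominus> a \<odot> y"
  by (simp add: minus_conv smult_add_right smult_smult mult.commute)

lemma diff_add_diff:
  "\<lbrakk>x \<in> carrier V; y \<in> carrier V; z \<in> carrier V\<rbrakk> \<Longrightarrow> (x \<ominus> y) \<oplus> (y \<ominus> z) = x \<ominus> z"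
  by (simp add: M.minus_eq M.a_assoc M.r_neg1)

end

text \<open>Completeness is left out on purpose: the constructions below first obtain a normed space
  and then use its limits to prove completeness.\<close>

locale normed_carrier = complex_vs V for V :: "(complex, 'a, 'm) module_scheme" (structure) +
  fixes n :: "'a \<Rightarrow> real"
  assumes norm_nonneg: "x \<in> carrier V \<Longrightarrow> 0 \<le> n x"
    and norm_eq_0: "x \<in> carrier V \<Longrightarrow> n x = 0 \<longleftrightarrow> x = \<zero>"
    and norm_triangle: "\<lbrakk>x \<in> carrier V; y \<in> carrier V\<rbrakk> \<Longrightarrow> n (x \<oplus> y) \<le> n x + n y"
    and norm_smult: "x \<in> carrier V \<Longrightarrow> n (a \<odot> x) = cmod a * n x"
begin

lemma norm_zero [simp]: "n \<zero> = 0"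
  using norm_eq_0[of \<zero>] by simp

lemma norm_diff_triangle:
  "\<lbrakk>x \<in> carrier V; y \<in> carrier V; z \<in> carrier V\<rbrakk> \<Longrightarrow> n (x \<ominus> z) \<le> n (x \<ominus> y) + n (y \<ominus> z)"
  using norm_triangle[of "x \<ominus> y" "y \<ominus> z"] by (simp add: diff_add_diff)

lemma norm_diff_commute: "x \<in> carrier V \<Longrightarrow> y \<in> carrier V \<Longrightarrow> n (x \<ominus> y) = n (y \<ominus> x)"
proof -
  assume x: "x \<in> carrier V" and y: "y \<in> carrier V"
  have "(-1) \<odot> (y \<ominus> x) = x \<ominus> y"
    using x y by (simp add: minus_conv smult_add_right smult_smult M.a_comm)
  then show ?thesis using norm_smult[of "y \<ominus> x" "-1"] x y by simp
qed

lemma norm_le_diff: "x \<in> carrier V \<Longrightarrow> y \<in> carrier V \<Longrightarrow> n x \<le> n y + n (x \<ominus> y)"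
  using norm_triangle[of y "x \<ominus> y"]
  by (simp add: M.minus_eq M.a_lcomm[of y] M.r_neg)

section \<open>The metric of the norm and limits of sequences\<close>

lemma metric: "Metric_space (carrier V) (norm_dist V n)"
proof
  fix x y z
  show "0 \<le> norm_dist V n x y" by (auto simp: norm_dist_def norm_nonneg)
  show "norm_dist V n x y = norm_dist V n y x" by (auto simp: norm_dist_def norm_diff_commute)
  show "norm_dist V n x y = 0 \<longleftrightarrow> x = y" if "x \<in> carrier V" "y \<in> carrier V"
    using that by (auto simp: norm_dist_def norm_eq_0 minus_eq_zero)
  show "norm_dist V n x z \<le> norm_dist V n x y + norm_dist V n y z"
    if "x \<in> carrier V" "y \<in> carrier V" "z \<in> carrier V"
    using that by (simp add: norm_dist_def norm_diff_triangle)
qed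

interpretation metric: Metric_space "carrier V" "norm_dist V n"
  by (rule metric)

lemma limitin_iff_tends:
  assumes "range f \<subseteq> carrier V"
  shows "limitin metric.mtopology f x sequentially \<longleftrightarrow> tends V n f x"
proof -
  have f: "f k \<in> carrier V" for k using assms by auto
  show ?thesis
    using assms f
    by (cases "x \<in> carrier V") (auto simp: metric.limitin_metric_dist_null tends_def norm_dist_def)
qed

lemma closedin_iff_tends:
  "closedin (norm_topology V n) T \<longleftrightarrow>
    T \<subseteq> carrier V \<and> (\<forall>f x. range f \<subseteq> T \<longrightarrow> tends V n f x \<longrightarrow> x \<in> T)"
  unfolding norm_topology_def metric.metric_closedin_iff_sequentially_closed
  using limitin_iff_tends by (metis subset_trans)

lemma tends_closedin:
  assumes "closedin (norm_topology V n) T" "tends V n f x" "\<And>k. f k \<in> T"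
  shows "x \<in> T"
proof -
  have "range f \<subseteq> T" using assms(3) by auto
  then show ?thesis using assms(1,2) unfolding closedin_iff_tends by simp
qed

text \<open>In the carrier the default value of \<open>norm_dist\<close> never occurs, so metric
  Cauchy sequences are those whose differences become small in norm.\<close>

lemma norm_complete_iff_tends:
  "norm_complete V n \<longleftrightarrow>
    (\<forall>f. range f \<subseteq> carrier V \<longrightarrow> (\<forall>e>0. \<exists>N. \<forall>k\<ge>N. \<forall>m\<ge>N. n (f k \<ominus> f m) < e) \<longrightarrow> (\<exists>x. tends V n f x))"
proof -
  have "metric.MCauchy f \<longleftrightarrow>
      range f \<subseteq> carrier V \<and> (\<forall>e>0. \<exists>N. \<forall>k\<ge>N. \<forall>m\<ge>N. n (f k \<ominus> f m) < e)" for f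
  proof -
    have "norm_dist V n (f k) (f m) = n (f k \<ominus> f m)" if "range f \<subseteq> carrier V" for k m
      using that by (auto simp: norm_dist_def)
    then show ?thesis unfolding metric.MCauchy_def by (metis (no_types, lifting))
  qed
  then show ?thesis
    unfolding norm_complete_def metric.mcomplete_def
    using limitin_iff_tends by (metis (no_types, lifting))
qed

lemma tends_in: "tends V n f x \<Longrightarrow> f k \<in> carrier V" "tends V n f x \<Longrightarrow> x \<in> carrier V"
  by (auto simp: tends_def)

lemma tendsI:
  assumes "\<And>k. f k \<in> carrier V" "x \<in> carrier V" "\<And>k. n (f k \<ominus> x) \<le> r k" "r \<longlonglongrightarrow> 0"
  shows "tends V n f x"
  unfolding tends_def
proof (intro conjI)
  show "(\<lambda>k. n (f k \<ominus> x)) \<longlonglongrightarrow> 0"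
    by (rule tendsto_sandwich[OF always_eventually always_eventually tendsto_const assms(4)])
      (use assms in \<open>auto intro: norm_nonneg\<close>)
qed (use assms in auto)

lemma tends_const [intro]: "x \<in> carrier V \<Longrightarrow> tends V n (\<lambda>k. x) x"
  by (auto simp: tends_def M.r_neg M.minus_eq)

lemma tends_unique: "tends V n f x \<Longrightarrow> tends V n f y \<Longrightarrow> x = y"
  using limitin_iff_tends metric.limitin_metric_unique
  by (metis tends_def trivial_limit_sequentially)

lemma tends_add:
  assumes "tends V n f x" "tends V n g y"
  shows "tends V n (\<lambda>k. f k \<oplus> g k) (x \<oplus> y)"
proof (rule tendsI)
  show "n ((f k \<oplus> g k) \<ominus> (x \<oplus> y)) \<le> n (f k \<ominus> x) + n (g k \<ominus> y)" for k
    using assms[THEN tends_in(1)] assms[THEN tends_in(2)] by (simp add: add_diff_add norm_triangle)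
  show "(\<lambda>k. n (f k \<ominus> x) + n (g k \<ominus> y)) \<longlonglongrightarrow> 0"
    using assms tendsto_add[of _ 0 _ _ 0] by (auto simp: tends_def)
qed (use assms[THEN tends_in(1)] assms[THEN tends_in(2)] in auto)

lemma tends_smult:
  assumes "tends V n f x"
  shows "tends V n (\<lambda>k. a \<odot> f k) (a \<odot> x)"
proof (rule tendsI)
  show "n (a \<odot> f k \<ominus> a \<odot> x) \<le> cmod a * n (f k \<ominus> x)" for k
    using tends_in[OF assms] by (simp flip: smult_diff add: norm_smult)
  show "(\<lambda>k. cmod a * n (f k \<ominus> x)) \<longlonglongrightarrow> 0"
    using assms by (auto simp: tends_def intro: tendsto_mult_right_zero)
qed (use tends_in[OF assms] in auto)

lemma tends_norm:
  assumes "tends V n f x"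
  shows "(\<lambda>k. n (f k)) \<longlonglongrightarrow> n x"
proof -
  have bound: "\<bar>n (f k) - n x\<bar> \<le> n (f k \<ominus> x)" for k
    using norm_le_diff[of "f k" x] norm_le_diff[of x "f k"] norm_diff_commute[of x "f k"] tends_in[OF assms]
    by (auto simp: abs_le_iff)
  have lim: "(\<lambda>k. n (f k \<ominus> x)) \<longlonglongrightarrow> 0"
    using assms by (simp add: tends_def)
  have "(\<lambda>k. \<bar>n (f k) - n x\<bar>) \<longlonglongrightarrow> 0"
    by (rule tendsto_sandwich[OF always_eventually always_eventually tendsto_const lim])
      (auto intro: bound)
  then show ?thesis
    by (rule LIM_zero_cancel[OF tendsto_rabs_zero_cancel])
qed

end

section \<open>C*-algebras and *-homomorphisms\<close>

context cstar_algebra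
begin

sublocale normed_carrier A "cnorm A"
  by (intro normed_carrier.intro complex_vs.intro normed_carrier_axioms.intro vector_space)
    (auto simp: cnorm_nonneg cnorm_triangle cnorm_eq_0 cnorm_smult)

declare mult_closed [simp] star_closed [simp] star_star [simp]

lemma mult_zero_left [simp]: "x \<in> carrier A \<Longrightarrow> \<zero> \<otimes> x = \<zero>"
  using smult_mult_left[of \<zero> x 0] by simp

lemma mult_zero_right [simp]: "x \<in> carrier A \<Longrightarrow> x \<otimes> \<zero> = \<zero>"
  using smult_mult_right[of x \<zero> 0] by simp

lemma mult_diff_left:
  "\<lbrakk>x \<in> carrier A; y \<in> carrier A; z \<in> carrier A\<rbrakk> \<Longrightarrow> (x \<ominus> y) \<otimes> z = x \<otimes> z \<ominus> y \<otimes> z"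
  by (simp add: minus_conv distrib_right smult_mult_left)

lemma mult_diff_right:
  "\<lbrakk>x \<in> carrier A; y \<in> carrier A; z \<in> carrier A\<rbrakk> \<Longrightarrow> z \<otimes> (x \<ominus> y) = z \<otimes> x \<ominus> z \<otimes> y"
  by (simp add: minus_conv distrib_left smult_mult_right)

lemma star_zero [simp]: "star A \<zero> = \<zero>"
  using star_smult[of \<zero> 0] by simp

lemma star_diff:
  "\<lbrakk>x \<in> carrier A; y \<in> carrier A\<rbrakk> \<Longrightarrow> star A (x \<ominus> y) = star A x \<ominus> star A y"
  by (simp add: minus_conv star_add star_smult)

text \<open>Submultiplicativity turns the C*-identity into
  \<open>(cnorm A x)\<^sup>2 \<le> cnorm A (star A x) * cnorm A x\<close>, and a nonzero factor
  cancels.\<close>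

lemma cnorm_le_star: "x \<in> carrier A \<Longrightarrow> cnorm A x \<le> cnorm A (star A x)"
proof -
  assume x: "x \<in> carrier A"
  have "(cnorm A x)\<^sup>2 \<le> cnorm A (star A x) * cnorm A x"
    using cnorm_mult[of "star A x" x] cstar_identity[of x] x by simp
  then show ?thesis
    using cnorm_nonneg[OF x] cnorm_nonneg[of "star A x"] x
    by (cases "cnorm A x = 0") (auto simp: power2_eq_square)
qed

lemma cnorm_star [simp]: "x \<in> carrier A \<Longrightarrow> cnorm A (star A x) = cnorm A x"
  using cnorm_le_star[of x] cnorm_le_star[of "star A x"] by simp

lemma tends_star:
  assumes f: "tends A (cnorm A) f x"
  shows "tends A (cnorm A) (\<lambda>k. star A (f k)) (star A x)"
proof (rule tendsI)
  show "cnorm A (star A (f k) \<ominus> star A x) \<le> cnorm A (f k \<ominus> x)" for k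
    using tends_in[OF f] by (simp flip: star_diff)
  show "(\<lambda>k. cnorm A (f k \<ominus> x)) \<longlonglongrightarrow> 0"
    using f by (simp add: tends_def)
qed (use tends_in[OF f] in auto)

lemma tends_mult:
  assumes "tends A (cnorm A) f x" "tends A (cnorm A) g y"
  shows "tends A (cnorm A) (\<lambda>k. f k \<otimes> g k) (x \<otimes> y)"
proof (rule tendsI)
  note [simp] = assms[THEN tends_in(1)] assms[THEN tends_in(2)]
  show "cnorm A (f k \<otimes> g k \<ominus> x \<otimes> y)
      \<le> cnorm A (f k \<ominus> x) * cnorm A (g k) + cnorm A x * cnorm A (g k \<ominus> y)" for k
  proof -
    \<comment> \<open>In this split the norms of \<open>g k\<close> converge, so both products of
      norms tend to zero.\<close>
    have "f k \<otimes> g k \<ominus> x \<otimes> y = (f k \<ominus> x) \<otimes> g k \<oplus> x \<otimes> (g k \<ominus> y)"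
      by (simp add: mult_diff_left mult_diff_right diff_add_diff)
    then show ?thesis
      using norm_triangle[of "(f k \<ominus> x) \<otimes> g k" "x \<otimes> (g k \<ominus> y)"]
        cnorm_mult[of "f k \<ominus> x" "g k"] cnorm_mult[of x "g k \<ominus> y"] by simp
  qed
  have "(\<lambda>k. cnorm A (f k \<ominus> x) * cnorm A (g k) + cnorm A x * cnorm A (g k \<ominus> y))
      \<longlonglongrightarrow> 0 * cnorm A y + cnorm A x * 0"
    using assms by (intro tendsto_intros tends_norm) (auto simp: tends_def)
  then show "(\<lambda>k. cnorm A (f k \<ominus> x) * cnorm A (g k) + cnorm A x * cnorm A (g k \<ominus> y)) \<longlonglongrightarrow> 0"
    by simp
qed (use assms[THEN tends_in(1)] assms[THEN tends_in(2)] in auto)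

lemma cstar_complete:
  assumes "range f \<subseteq> carrier A" "\<And>e. e > 0 \<Longrightarrow> \<exists>N. \<forall>k\<ge>N. \<forall>m\<ge>N. cnorm A (f k \<ominus> f m) < e"
  shows "\<exists>x. tends A (cnorm A) f x"
  using complete assms unfolding norm_complete_iff_tends by blast

text \<open>Here \<open>p + iq\<close> and \<open>p - iq\<close> have the same square norm, and their mean is \<open>p\<close>.\<close>

lemma cnorm_le_sum_of_squares:
  assumes p: "p \<in> carrier A" and q: "q \<in> carrier A"
    and eq: "star A p \<otimes> q = star A q \<otimes> p"
  shows "(cnorm A p)\<^sup>2 \<le> cnorm A (star A p \<otimes> p \<oplus> star A q \<otimes> q)"
proof -
  define S where "S = star A p \<otimes> p \<oplus> star A q \<otimes> q"
  \<comment> \<open>The values needed are \<open>c = \<i>\<close> and \<open>c = - \<i>\<close>. By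
    \<open>eq\<close> both mixed terms of the square are multiples of the same \<open>z\<close>,
    with coefficients \<open>c\<close> and \<open>cnj c = - c\<close>, so they cancel.\<close>
  have sq: "(cnorm A (p \<oplus> c \<odot> q))\<^sup>2 = cnorm A S" if c: "cnj c = - c" "c * c = - 1" for c
  proof -
    define z where "z = star A p \<otimes> q"
    have z: "z \<in> carrier A" "z = star A q \<otimes> p"
      using p q eq by (auto simp: z_def)
    have "star A (p \<oplus> c \<odot> q) \<otimes> (p \<oplus> c \<odot> q) =
        star A p \<otimes> p \<oplus> (- c) \<odot> z \<oplus> (c \<odot> z \<oplus> star A q \<otimes> q)"
      using p q c z(1)
      by (simp add: star_add star_smult smult_add_right distrib_left distrib_right smult_mult_left smult_mult_right
          smult_smult flip: eq z_def)
    also have "\<dots> = star A p \<otimes> p \<oplus> ((- c) \<odot> z \<oplus> c \<odot> z) \<oplus> star A q \<otimes> q"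
      using p q z by (simp add: M.a_assoc)
    also have "(- c) \<odot> z \<oplus> c \<odot> z = \<zero>"
      using z(1) by (simp flip: smult_add_left)
    finally have "star A (p \<oplus> c \<odot> q) \<otimes> (p \<oplus> c \<odot> q) = S"
      using p q by (simp add: S_def)
    then show ?thesis
      using cstar_identity[of "p \<oplus> c \<odot> q"] p q by simp
  qed
  have "2 \<odot> p = (p \<oplus> \<i> \<odot> q) \<oplus> (p \<oplus> (- \<i>) \<odot> q)"
  proof -
    have "(p \<oplus> \<i> \<odot> q) \<oplus> (p \<oplus> (- \<i>) \<odot> q) = (p \<oplus> p) \<oplus> (\<i> \<odot> q \<oplus> (- \<i>) \<odot> q)"
      using p q by (simp add: M.a_ac)
    also have "\<i> \<odot> q \<oplus> (- \<i>) \<odot> q = \<zero>"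
      using q by (simp flip: smult_add_left)
    also have "p \<oplus> p = 2 \<odot> p"
      using smult_add_left[of p 1 1] p by simp
    finally show ?thesis using p by simp
  qed
  then have "2 * cnorm A p \<le> cnorm A (p \<oplus> \<i> \<odot> q) + cnorm A (p \<oplus> (- \<i>) \<odot> q)"
    using norm_triangle[of "p \<oplus> \<i> \<odot> q" "p \<oplus> (- \<i>) \<odot> q"] norm_smult[of p 2] p q by simp
  moreover have "cnorm A (p \<oplus> (- \<i>) \<odot> q) = cnorm A (p \<oplus> \<i> \<odot> q)"
    by (rule power2_eq_imp_eq) (use sq[of \<i>] sq[of "- \<i>"] p q in \<open>auto simp: cnorm_nonneg\<close>)
  ultimately have "cnorm A p \<le> cnorm A (p \<oplus> \<i> \<odot> q)" by simp
  then have "(cnorm A p)\<^sup>2 \<le> (cnorm A (p \<oplus> \<i> \<odot> q))\<^sup>2"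
    using cnorm_nonneg[OF p] by (rule power_mono)
  then show ?thesis
    using sq[of \<i>] by (simp add: S_def)
qed

text \<open>Formally \<open>(1 - w)\<^sup>2 = 1 - b\<^sup>2\<close>, so that \<open>b + i(1 - w)\<close> is unitary.\<close>

lemma cnorm_le_1:
  assumes b: "b \<in> carrier A" "star A b = b" and w: "w \<in> carrier A" "star A w = w"
    and comm: "b \<otimes> w = w \<otimes> b" and sqrt: "2 \<odot> w = b \<otimes> b \<oplus> w \<otimes> w"
  shows "cnorm A b \<le> 1"
proof -
  \<comment> \<open>There need be no unit, so the formal unitary \<open>u = b + i(1 - w)\<close>
    enters only through the product \<open>u b = p + i q\<close>, whose two terms \<open>b b\<close>
    and \<open>b - w b\<close> lie in the algebra.\<close>
  define p q where "p = b \<otimes> b" and "q = b \<ominus> w \<otimes> b"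
  have p: "p \<in> carrier A" "star A p = p"
    using b by (auto simp: p_def star_mult)
  have q: "q \<in> carrier A" "star A q = b \<ominus> b \<otimes> w"
    using b w by (auto simp: q_def star_mult star_diff)
  have "b \<otimes> (w \<otimes> b) = w \<otimes> (b \<otimes> b)"
    using b w comm by (simp flip: mult_assoc)
  then have "star A p \<otimes> q = star A q \<otimes> p"
    unfolding p(2) q(2) unfolding p_def q_def using b w
    by (simp add: mult_diff_left mult_diff_right mult_assoc)
  \<comment> \<open>Formally this is \<open>b (b b + (1 - w)(1 - w)) b = b b\<close>. With
    \<open>z = b w b\<close>, the hypothesis \<open>sqrt\<close> multiplied by \<open>b\<close> on
    both sides reads \<open>2 z = p p + b w w b\<close>.\<close>
  moreover have "star A p \<otimes> p \<oplus> star A q \<otimes> q = p"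
  proof -
    define z where "z = b \<otimes> (w \<otimes> b)"
    have z: "z \<in> carrier A" using b w by (simp add: z_def)
    have "2 \<odot> z = b \<otimes> ((2 \<odot> w) \<otimes> b)"
      using b w by (simp add: z_def smult_mult_left smult_mult_right)
    also have "\<dots> = p \<otimes> p \<oplus> b \<otimes> (w \<otimes> (w \<otimes> b))"
      using b w by (simp add: sqrt distrib_left distrib_right p_def mult_assoc)
    finally have z2: "p \<otimes> p \<oplus> b \<otimes> (w \<otimes> (w \<otimes> b)) = 2 \<odot> z" ..
    have "star A q \<otimes> q = p \<oplus> (- 1) \<odot> z \<oplus> ((- 1) \<odot> z \<oplus> b \<otimes> (w \<otimes> (w \<otimes> b)))"
      unfolding q(2) unfolding q_def p_def z_def using b w
      by (simp add: minus_conv distrib_left distrib_right smult_mult_left smult_mult_right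
          mult_assoc smult_smult smult_add_right)
    then have "star A p \<otimes> p \<oplus> star A q \<otimes> q =
        p \<oplus> ((- 1) \<odot> z \<oplus> (- 1) \<odot> z) \<oplus> (p \<otimes> p \<oplus> b \<otimes> (w \<otimes> (w \<otimes> b)))"
      using p b w z by (simp add: M.a_ac)
    also have "\<dots> = p \<oplus> (((- 1) \<odot> z \<oplus> (- 1) \<odot> z) \<oplus> 2 \<odot> z)"
      using p z by (simp add: z2 M.a_assoc)
    also have "\<dots> = p"
      using p z by (simp flip: smult_add_left)
    finally show ?thesis .
  qed
  ultimately have "(cnorm A p)\<^sup>2 \<le> cnorm A p"
    using cnorm_le_sum_of_squares[OF p(1) q(1)] by simp
  then have "cnorm A p \<le> 1"
    using power_strict_increasing[of 1 2 "cnorm A p"] by (cases "1 < cnorm A p") auto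
  moreover have "cnorm A p = (cnorm A b)\<^sup>2"
    using cstar_identity[of b] b by (simp add: p_def)
  ultimately show ?thesis
    using power2_le_imp_le[of "cnorm A b" 1] by simp
qed

text \<open>With \<open>s = 1 - y\<close> the last equation says \<open>s s = 1 - x x\<close>. It is
  the fixed point equation of \<open>F\<close>, which maps the ball of radius 1/2 into itself and is
  a contraction there with factor 1/2. The iterates from zero are self-adjoint and commute with
  \<open>x\<close>, and so does their limit.\<close>

lemma sqrt_one_minus_square:
  assumes x: "x \<in> carrier A" "star A x = x" "cnorm A x \<le> 1/2"
  obtains y where "y \<in> carrier A" "star A y = y" "x \<otimes> y = y \<otimes> x" "2 \<odot> y = x \<otimes> x \<oplus> y \<otimes> y"
proof -
  define F where "F y = (1/2) \<odot> (x \<otimes> x \<oplus> y \<otimes> y)" for y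
  define u where "u k = (F ^^ k) \<zero>" for k
  have u_Suc: "u (Suc k) = F (u k)" for k
    by (simp add: u_def)
  have u: "u k \<in> carrier A \<and> star A (u k) = u k \<and> x \<otimes> u k = u k \<otimes> x \<and> cnorm A (u k) \<le> 1/2" for k
  proof (induction k)
    case 0
    then show ?case using x by (simp add: u_def)
  next
    case (Suc k)
    have "cnorm A (u (Suc k)) \<le> 1/2 * (cnorm A (x \<otimes> x) + cnorm A (u k \<otimes> u k))"
      using Suc x norm_triangle[of "x \<otimes> x" "u k \<otimes> u k"] by (simp add: u_Suc F_def norm_smult)
    also have "\<dots> \<le> 1/2 * (1/2 * (1/2) + 1/2 * (1/2))"
      using Suc x cnorm_mult[of x x] cnorm_mult[of "u k" "u k"] cnorm_nonneg
      by (intro mult_left_mono add_mono order.trans[OF cnorm_mult] mult_mono) auto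
    finally have "cnorm A (u (Suc k)) \<le> 1/2" by simp
    moreover have "x \<otimes> (u k \<otimes> u k) = u k \<otimes> u k \<otimes> x"
      using Suc x by (metis mult_assoc)
    ultimately show ?case
      using Suc x
      by (simp add: u_Suc F_def star_smult star_add star_mult smult_mult_left smult_mult_right
          distrib_left distrib_right mult_assoc)
  qed
  note uc = u[THEN conjunct1]
  \<comment> \<open>Splitting \<open>y y - z z\<close> as \<open>(y - z) y + z (y - z)\<close> costs
    the factor 1/2 + 1/2, and the scalar 1/2 in \<open>F\<close> remains.\<close>
  have step: "cnorm A (F y \<ominus> F z) \<le> 1/2 * cnorm A (y \<ominus> z)"
    if y: "y \<in> carrier A" "cnorm A y \<le> 1/2" and z: "z \<in> carrier A" "cnorm A z \<le> 1/2" for y z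
  proof -
    have "F y \<ominus> F z = (1/2) \<odot> ((x \<otimes> x \<ominus> x \<otimes> x) \<oplus> (y \<otimes> y \<ominus> z \<otimes> z))"
      using x y z by (simp add: F_def add_diff_add flip: smult_diff)
    also have "\<dots> = (1/2) \<odot> (y \<otimes> y \<ominus> z \<otimes> z)"
      using x y z by (simp add: M.minus_eq M.r_neg)
    also have "y \<otimes> y \<ominus> z \<otimes> z = (y \<ominus> z) \<otimes> y \<oplus> z \<otimes> (y \<ominus> z)"
      using y z by (simp add: mult_diff_left mult_diff_right diff_add_diff)
    finally have "cnorm A (F y \<ominus> F z) = 1/2 * cnorm A ((y \<ominus> z) \<otimes> y \<oplus> z \<otimes> (y \<ominus> z))"
      using y z by (simp add: norm_smult)
    also have "\<dots> \<le> 1/2 * (cnorm A (y \<ominus> z) * (1/2) + 1/2 * cnorm A (y \<ominus> z))"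
      using y z
      by (intro mult_left_mono order.trans[OF norm_triangle] add_mono order.trans[OF cnorm_mult]
          mult_mono) (auto simp: cnorm_nonneg)
    finally show ?thesis by simp
  qed
  \<comment> \<open>For fixed \<open>m\<close>, one application of \<open>F\<close> advances both
    indices. At \<open>k = 0\<close> the term \<open>u 0\<close> is zero and all iterates have norm
    at most 1/2.\<close>
  have diff: "cnorm A (u (k + m) \<ominus> u k) \<le> (1/2) ^ k" for k m
  proof (induction k)
    case 0
    have "u 0 = \<zero>" by (simp add: u_def)
    then show ?case using u[of m] by (simp add: minus_conv)
  next
    case (Suc k)
    show ?case
      using step[of "u (k + m)" "u k"] u Suc by (simp add: u_Suc)
  qed
  have "\<exists>y. tends A (cnorm A) u y"
  proof (rule cstar_complete)
    show "range u \<subseteq> carrier A" using uc by auto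
    fix e :: real assume "e > 0"
    then obtain N where N: "(1/2 :: real) ^ N < e/2"
      using real_arch_pow_inv[of "e/2" "1/2"] by auto
    have near: "cnorm A (u k \<ominus> u N) < e/2" if "k \<ge> N" for k
      using diff[of N "k - N"] N that by simp
    have "cnorm A (u k \<ominus> u m) < e" if "k \<ge> N" "m \<ge> N" for k m
      using near[OF that(1)] near[OF that(2)] norm_diff_triangle[OF uc[of k] uc[of N] uc[of m]]
        norm_diff_commute[OF uc[of N] uc[of m]] by linarith
    then show "\<exists>N. \<forall>k\<ge>N. \<forall>m\<ge>N. cnorm A (u k \<ominus> u m) < e" by blast
  qed
  then obtain y where y: "tends A (cnorm A) u y" by blast
  show thesis
  proof
    show yc: "y \<in> carrier A" using tends_in[OF y] by simp
    show "star A y = y"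
      using tends_unique[OF tends_star[OF y]] y u by simp
    show "x \<otimes> y = y \<otimes> x"
      using tends_unique[OF tends_mult[OF tends_const[OF x(1)] y]] tends_mult[OF y tends_const[OF x(1)]] u
      by simp
    \<comment> \<open>The sequences \<open>F (u k)\<close> and \<open>u (Suc k)\<close> coincide;
      uniqueness of the limit makes \<open>y\<close> a fixed point.\<close>
    have "tends A (cnorm A) (\<lambda>k. F (u k)) (F y)"
      unfolding F_def by (intro tends_smult tends_add tends_mult tends_const y) (use x in simp)
    moreover have "tends A (cnorm A) (\<lambda>k. u (Suc k)) y"
      using y LIMSEQ_Suc by (auto simp: tends_def)
    ultimately have "F y = y"
      using tends_unique by (simp add: u_Suc)
    then have "2 \<odot> F y = 2 \<odot> y" by simp
    then show "2 \<odot> y = x \<otimes> x \<oplus> y \<otimes> y"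
      using x yc by (simp add: F_def smult_smult)
  qed
qed

end

section \<open>Star-homomorphisms and their norm continuity\<close>

lemma star_homD:
  assumes "star_hom A B h" "x \<in> carrier A"
  shows star_hom_closed: "h x \<in> carrier B"
    and star_hom_star: "h (star A x) = star B (h x)"
    and star_hom_smult: "h (a \<odot>\<^bsub>A\<^esub> x) = a \<odot>\<^bsub>B\<^esub> h x"
    and star_hom_add: "y \<in> carrier A \<Longrightarrow> h (x \<oplus>\<^bsub>A\<^esub> y) = h x \<oplus>\<^bsub>B\<^esub> h y"
    and star_hom_mult: "y \<in> carrier A \<Longrightarrow> h (x \<otimes>\<^bsub>A\<^esub> y) = h x \<otimes>\<^bsub>B\<^esub> h y"
  using assms by (auto simp: star_hom_def)

lemma star_hom_comp: "star_hom A B g \<Longrightarrow> star_hom B C h \<Longrightarrow> star_hom A C (\<lambda>x. h (g x))"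
  by (auto simp: star_hom_def Pi_iff)

lemma star_hom_id: "star_hom A A (\<lambda>x. x)"
  by (simp add: star_hom_def)

locale cstar_hom = A: cstar_algebra A + B: cstar_algebra B
  for A :: "'a cstar_algebra" and B :: "'b cstar_algebra" +
  fixes h :: "'a \<Rightarrow> 'b"
  assumes hom: "star_hom A B h"
begin

lemmas hom_simps = star_homD[OF hom]
declare hom_simps(1) [simp]

lemma hom_zero [simp]: "h \<zero>\<^bsub>A\<^esub> = \<zero>\<^bsub>B\<^esub>"
  using hom_simps(3)[of "\<zero>\<^bsub>A\<^esub>" 0] by simp

lemma hom_diff: "x \<in> carrier A \<Longrightarrow> y \<in> carrier A \<Longrightarrow> h (x \<ominus>\<^bsub>A\<^esub> y) = h x \<ominus>\<^bsub>B\<^esub> h y"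
  by (simp add: A.minus_conv B.minus_conv hom_simps)

text \<open>Rescaled to norm 1/2, a nonzero \<open>x\<close> has a companion \<open>y\<close> from
  \<open>sqrt_one_minus_square\<close>. Its defining relations are algebraic, so \<open>h\<close>
  carries them to \<open>B\<close>, where \<open>cnorm_le_1\<close> applies. Undoing the scaling
  gives the factor 2; any constant suffices for continuity.\<close>

lemma cnorm_hom_le_self_adjoint:
  assumes x: "x \<in> carrier A" "star A x = x"
  shows "cnorm B (h x) \<le> 2 * cnorm A x"
proof (cases "x = \<zero>\<^bsub>A\<^esub>")
  case False
  define r where "r = 1 / (2 * cnorm A x)"
  have pos: "cnorm A x > 0"
    using False A.cnorm_eq_0 A.cnorm_nonneg x(1) by force
  define x' where "x' = complex_of_real r \<odot>\<^bsub>A\<^esub> x"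
  have x': "x' \<in> carrier A" "star A x' = x'" "cnorm A x' \<le> 1/2"
    using x pos by (auto simp: x'_def r_def A.star_smult A.cnorm_smult norm_divide norm_mult)
  obtain y where y: "y \<in> carrier A" "star A y = y" "x' \<otimes>\<^bsub>A\<^esub> y = y \<otimes>\<^bsub>A\<^esub> x'"
    "2 \<odot>\<^bsub>A\<^esub> y = x' \<otimes>\<^bsub>A\<^esub> x' \<oplus>\<^bsub>A\<^esub> y \<otimes>\<^bsub>A\<^esub> y"
    using A.sqrt_one_minus_square[OF x'] by blast
  have "cnorm B (h x') \<le> 1"
  proof (rule B.cnorm_le_1)
    show "star B (h x') = h x'" "star B (h y) = h y"
      using x' y by (simp_all flip: hom_simps(2))
    show "h x' \<otimes>\<^bsub>B\<^esub> h y = h y \<otimes>\<^bsub>B\<^esub> h x'"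
      using x' y by (simp flip: hom_simps(5))
    have "h (2 \<odot>\<^bsub>A\<^esub> y) = h (x' \<otimes>\<^bsub>A\<^esub> x' \<oplus>\<^bsub>A\<^esub> y \<otimes>\<^bsub>A\<^esub> y)"
      using y(4) by simp
    then show "2 \<odot>\<^bsub>B\<^esub> h y = h x' \<otimes>\<^bsub>B\<^esub> h x' \<oplus>\<^bsub>B\<^esub> h y \<otimes>\<^bsub>B\<^esub> h y"
      using x' y(1) by (simp add: hom_simps)
  qed (use x' y in auto)
  then have "r * cnorm B (h x) \<le> 1"
    using x pos by (simp add: x'_def hom_simps B.cnorm_smult r_def norm_divide norm_mult)
  then show ?thesis
    using pos by (simp add: r_def field_simps)
qed simp

text \<open>The self-adjoint case applies to \<open>star A x \<otimes> x\<close>, and the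
  C*-identity in both algebras turns it into a bound on squares.\<close>

lemma cnorm_hom_le:
  assumes x: "x \<in> carrier A"
  shows "cnorm B (h x) \<le> 2 * cnorm A x"
proof -
  have "(cnorm B (h x))\<^sup>2 = cnorm B (h (star A x \<otimes>\<^bsub>A\<^esub> x))"
    using x by (simp add: hom_simps B.cstar_identity)
  also have "\<dots> \<le> 2 * cnorm A (star A x \<otimes>\<^bsub>A\<^esub> x)"
    using x by (intro cnorm_hom_le_self_adjoint) (auto simp: A.star_mult)
  also have "\<dots> \<le> (2 * cnorm A x)\<^sup>2"
    using x by (simp add: A.cstar_identity power_mult_distrib)
  finally show ?thesis
    by (rule power2_le_imp_le) (simp add: A.cnorm_nonneg x)
qed

lemma tends_hom:
  assumes "tends A (cnorm A) f x"
  shows "tends B (cnorm B) (\<lambda>k. h (f k)) (h x)"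
proof (rule B.tendsI)
  note [simp] = A.tends_in[OF assms]
  show "cnorm B (h (f k) \<ominus>\<^bsub>B\<^esub> h x) \<le> 2 * cnorm A (f k \<ominus>\<^bsub>A\<^esub> x)" for k
    using cnorm_hom_le[of "f k \<ominus>\<^bsub>A\<^esub> x"] by (simp add: hom_diff)
  show "(\<lambda>k. 2 * cnorm A (f k \<ominus>\<^bsub>A\<^esub> x)) \<longlonglongrightarrow> 0"
    using assms by (auto simp: tends_def intro: tendsto_mult_right_zero)
qed (use A.tends_in[OF assms] in auto)

end

section \<open>Constructions of C*-algebras\<close>

lemma cstar_algebra_zero:
  assumes "cstar_algebra A"
  shows "\<zero>\<^bsub>A\<^esub> \<in> carrier A" "cnorm A \<zero>\<^bsub>A\<^esub> = 0"
proof -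
  interpret cstar_algebra A by fact
  show "\<zero>\<^bsub>A\<^esub> \<in> carrier A" "cnorm A \<zero>\<^bsub>A\<^esub> = 0" by simp_all
qed

text \<open>Common frame for copies and products of C*-algebras. An identity holds in
  \<open>B\<close> if it holds after every \<open>\<rho> i\<close>, and the norm is the supremum of
  the norms of the images, so all axioms but completeness are inherited. The inserted 0 gives the
  norm 0 for an empty family.\<close>

locale star_family =
  fixes B :: "'b cstar_algebra" (structure) and I :: "'i set" and A :: "'i \<Rightarrow> 'a cstar_algebra"
    and \<rho> :: "'i \<Rightarrow> 'b \<Rightarrow> 'a"
  assumes cstar: "i \<in> I \<Longrightarrow> cstar_algebra (A i)"
    and hom: "i \<in> I \<Longrightarrow> star_hom B (A i) (\<rho> i)"
    and hom_zero: "i \<in> I \<Longrightarrow> \<rho> i \<zero> = \<zero>\<^bsub>A i\<^esub>"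
    and closed: "\<zero> \<in> carrier B" "\<lbrakk>x \<in> carrier B; y \<in> carrier B\<rbrakk> \<Longrightarrow> x \<oplus> y \<in> carrier B"
      "\<lbrakk>x \<in> carrier B; y \<in> carrier B\<rbrakk> \<Longrightarrow> x \<otimes> y \<in> carrier B"
      "x \<in> carrier B \<Longrightarrow> star B x \<in> carrier B" "x \<in> carrier B \<Longrightarrow> a \<odot> x \<in> carrier B"
    and separating: "\<lbrakk>x \<in> carrier B; y \<in> carrier B; \<And>i. i \<in> I \<Longrightarrow> \<rho> i x = \<rho> i y\<rbrakk> \<Longrightarrow> x = y"
    and bdd: "x \<in> carrier B \<Longrightarrow> bdd_above ((\<lambda>i. cnorm (A i) (\<rho> i x)) ` I)"
    and cnorm_eq: "x \<in> carrier B \<Longrightarrow> cnorm B x = Sup (insert 0 ((\<lambda>i. cnorm (A i) (\<rho> i x)) ` I))"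
begin

lemmas hom_simps = star_homD[OF hom]

lemma cnorm_le_iff:
  assumes "x \<in> carrier B"
  shows "cnorm B x \<le> c \<longleftrightarrow> 0 \<le> c \<and> (\<forall>i\<in>I. cnorm (A i) (\<rho> i x) \<le> c)"
  using assms bdd[OF assms] by (subst cnorm_eq, simp, subst cSup_le_iff) auto

lemma cnorm_hom_le: "x \<in> carrier B \<Longrightarrow> i \<in> I \<Longrightarrow> cnorm (A i) (\<rho> i x) \<le> cnorm B x"
  using cnorm_le_iff[of x "cnorm B x"] by simp

lemma cnorm_ge_0: "x \<in> carrier B \<Longrightarrow> 0 \<le> cnorm B x"
  using cnorm_le_iff[of x "cnorm B x"] by simp

lemma vector_space: "complex_vector_space B"
proof (rule complex_vector_spaceI)
  fix x y z a b
  assume x: "x \<in> carrier B"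
  {
    assume y: "y \<in> carrier B"
    {
      assume z: "z \<in> carrier B"
      show "x \<oplus> y \<oplus> z = x \<oplus> (y \<oplus> z)"
      proof (rule separating)
        fix i assume i: "i \<in> I"
        interpret cstar_algebra "A i" by (rule cstar) fact
        show "\<rho> i (x \<oplus> y \<oplus> z) = \<rho> i (x \<oplus> (y \<oplus> z))"
          using i x y z by (simp add: hom_simps closed M.a_assoc)
      qed (use x y z closed in auto)
    }
    show "x \<oplus> y = y \<oplus> x"
    proof (rule separating)
      fix i assume i: "i \<in> I"
      interpret cstar_algebra "A i" by (rule cstar) fact
      show "\<rho> i (x \<oplus> y) = \<rho> i (y \<oplus> x)"
        using i x y by (simp add: hom_simps closed M.a_comm)
    qed (use x y closed in auto)
    show "a \<odot> (x \<oplus> y) = a \<odot> x \<oplus> a \<odot> y"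
    proof (rule separating)
      fix i assume i: "i \<in> I"
      interpret cstar_algebra "A i" by (rule cstar) fact
      show "\<rho> i (a \<odot> (x \<oplus> y)) = \<rho> i (a \<odot> x \<oplus> a \<odot> y)"
        using i x y by (simp add: hom_simps closed smult_add_right)
    qed (use x y closed in auto)
  }
  show "\<zero> \<oplus> x = x"
  proof (rule separating)
    fix i assume i: "i \<in> I"
    interpret cstar_algebra "A i" by (rule cstar) fact
    show "\<rho> i (\<zero> \<oplus> x) = \<rho> i x"
      using i x by (simp add: hom_simps hom_zero closed)
  qed (use x closed in auto)
  show "(a + b) \<odot> x = a \<odot> x \<oplus> b \<odot> x"
  proof (rule separating)
    fix i assume i: "i \<in> I"
    interpret cstar_algebra "A i" by (rule cstar) fact
    show "\<rho> i ((a + b) \<odot> x) = \<rho> i (a \<odot> x \<oplus> b \<odot> x)"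
      using i x by (simp add: hom_simps closed smult_add_left)
  qed (use x closed in auto)
  show "(a * b) \<odot> x = a \<odot> (b \<odot> x)"
  proof (rule separating)
    fix i assume i: "i \<in> I"
    interpret cstar_algebra "A i" by (rule cstar) fact
    show "\<rho> i ((a * b) \<odot> x) = \<rho> i (a \<odot> (b \<odot> x))"
      using i x by (simp add: hom_simps closed smult_smult)
  qed (use x closed in auto)
  show "1 \<odot> x = x"
  proof (rule separating)
    fix i assume i: "i \<in> I"
    interpret cstar_algebra "A i" by (rule cstar) fact
    show "\<rho> i (1 \<odot> x) = \<rho> i x"
      using i x by (simp add: hom_simps closed)
  qed (use x closed in auto)
  show "0 \<odot> x = \<zero>"
  proof (rule separating)
    fix i assume i: "i \<in> I"
    interpret cstar_algebra "A i" by (rule cstar) fact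
    show "\<rho> i (0 \<odot> x) = \<rho> i \<zero>"
      using i x by (simp add: hom_simps closed hom_zero)
  qed (use x closed in auto)
qed (use closed in auto)

lemma normed_carrier: "normed_carrier B (cnorm B)"
proof (intro normed_carrier.intro complex_vs.intro normed_carrier_axioms.intro vector_space)
  fix x assume x: "x \<in> carrier B"
  show "0 \<le> cnorm B x" by (rule cnorm_ge_0[OF x])
  have eq: "cnorm B x = 0 \<longleftrightarrow> (\<forall>i\<in>I. cnorm (A i) (\<rho> i x) = 0)"
    using cnorm_le_iff[OF x, of 0] cnorm_ge_0[OF x] cstar_algebra.cnorm_nonneg[OF cstar hom_simps(1)[OF _ x]]
    by (metis nle_le)
  also have "\<dots> \<longleftrightarrow> (\<forall>i\<in>I. \<rho> i x = \<zero>\<^bsub>A i\<^esub>)"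
    using cstar_algebra.cnorm_eq_0[OF cstar hom_simps(1)[OF _ x]] by simp
  also have "\<dots> \<longleftrightarrow> x = \<zero>"
    using separating[OF x closed(1)] hom_zero by auto
  finally show "cnorm B x = 0 \<longleftrightarrow> x = \<zero>" .
  \<comment> \<open>One half of homogeneity; the other half is the same bound for
    \<open>1 / a\<close> and \<open>a \<odot> x\<close>.\<close>
  have le: "cnorm B (a \<odot> x) \<le> cmod a * cnorm B x" if "x \<in> carrier B" for a x
    using that cnorm_ge_0[OF that] cnorm_hom_le[OF that]
    by (subst cnorm_le_iff)
      (auto simp: closed hom_simps cstar_algebra.cnorm_smult[OF cstar] intro: mult_left_mono)
  show "cnorm B (a \<odot> x) = cmod a * cnorm B x" for a
  proof (cases "a = 0")
    case True
    then show ?thesis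
      using le[OF x, of a] cnorm_ge_0[of "a \<odot> x"] closed(5)[OF x] by auto
  next
    case False
    interpret complex_vs B by (rule complex_vs.intro) (rule vector_space)
    have "cnorm B x \<le> cmod (1 / a) * cnorm B (a \<odot> x)"
      using le[of "a \<odot> x" "1 / a"] x False by (simp add: smult_smult)
    then show ?thesis
      using le[OF x, of a] False by (auto simp: norm_divide field_simps intro: antisym)
  qed
  show "cnorm B (x \<oplus> y) \<le> cnorm B x + cnorm B y" if y: "y \<in> carrier B" for y
    using x y cnorm_ge_0 closed
    by (subst cnorm_le_iff)
      (auto simp: hom_simps intro!: order.trans[OF cstar_algebra.cnorm_triangle[OF cstar]] add_mono cnorm_hom_le)
qed

lemma cstar_algebra:
  assumes "norm_complete B (cnorm B)"
  shows "cstar_algebra B"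
proof -
  interpret normed_carrier B "cnorm B" by (rule normed_carrier)
  have mult: "cnorm B (x \<otimes> y) \<le> cnorm B x * cnorm B y" if "x \<in> carrier B" "y \<in> carrier B" for x y
    using that cnorm_ge_0 closed
    by (subst cnorm_le_iff)
      (auto simp: hom_simps cstar_algebra.cnorm_nonneg[OF cstar]
        intro!: order.trans[OF cstar_algebra.cnorm_mult[OF cstar]] mult_mono cnorm_hom_le)
  show ?thesis
  proof (rule cstar_algebra.intro)
    fix x y z a
    assume x: "x \<in> carrier B"
    {
      assume y: "y \<in> carrier B"
      {
        assume z: "z \<in> carrier B"
        show "x \<otimes> y \<otimes> z = x \<otimes> (y \<otimes> z)"
          using x y z closed
          by (intro separating) (auto simp: hom_simps cstar_algebra.mult_assoc[OF cstar])
        show "(x \<oplus> y) \<otimes> z = x \<otimes> z \<oplus> y \<otimes> z"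
          using x y z closed
          by (intro separating) (auto simp: hom_simps cstar_algebra.distrib_right[OF cstar])
        show "z \<otimes> (x \<oplus> y) = z \<otimes> x \<oplus> z \<otimes> y"
          using x y z closed
          by (intro separating) (auto simp: hom_simps cstar_algebra.distrib_left[OF cstar])
      }
      show "(a \<odot> x) \<otimes> y = a \<odot> (x \<otimes> y)"
        using x y closed
        by (intro separating) (auto simp: hom_simps cstar_algebra.smult_mult_left[OF cstar])
      show "x \<otimes> (a \<odot> y) = a \<odot> (x \<otimes> y)"
        using x y closed
        by (intro separating) (auto simp: hom_simps cstar_algebra.smult_mult_right[OF cstar])
      show "star B (x \<oplus> y) = star B x \<oplus> star B y"
        using x y closed
        by (intro separating) (auto simp: hom_simps cstar_algebra.star_add[OF cstar])
      show "star B (x \<otimes> y) = star B y \<otimes> star B x"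
        using x y closed
        by (intro separating) (auto simp: hom_simps cstar_algebra.star_mult[OF cstar])
      show "cnorm B (x \<otimes> y) \<le> cnorm B x * cnorm B y"
        by (rule mult[OF x y])
    }
    show "star B (star B x) = x"
      using x closed
      by (intro separating) (auto simp: hom_simps cstar_algebra.star_star[OF cstar])
    show "star B (a \<odot> x) = cnj a \<odot> star B x"
      using x closed
      by (intro separating) (auto simp: hom_simps cstar_algebra.star_smult[OF cstar])
    have "cnorm B (star B x) \<le> cnorm B x"
      using x cnorm_ge_0 closed
      by (subst cnorm_le_iff)
        (auto simp: hom_simps cstar_algebra.cnorm_star[OF cstar] intro: cnorm_hom_le)
    then have "cnorm B (star B x \<otimes> x) \<le> (cnorm B x)\<^sup>2"
      using mult[of "star B x" x] mult_right_mono[OF _ cnorm_ge_0[OF x]] x closed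
      by (fastforce simp: power2_eq_square)
    \<comment> \<open>The C*-identity in each \<open>A i\<close> makes this square root an upper
      bound of all coordinate norms, hence of their supremum.\<close>
    moreover have "cnorm B x \<le> sqrt (cnorm B (star B x \<otimes> x))"
    proof (subst cnorm_le_iff[OF x], intro conjI ballI)
      fix i assume i: "i \<in> I"
      have "(cnorm (A i) (\<rho> i x))\<^sup>2 = cnorm (A i) (\<rho> i (star B x \<otimes> x))"
        using x i closed by (simp add: hom_simps cstar_algebra.cstar_identity[OF cstar])
      also have "\<dots> \<le> cnorm B (star B x \<otimes> x)"
        using x i closed by (intro cnorm_hom_le) auto
      finally show "cnorm (A i) (\<rho> i x) \<le> sqrt (cnorm B (star B x \<otimes> x))"
        by (rule real_le_rsqrt)
    qed (use x closed cnorm_ge_0 in auto)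
    then have "(cnorm B x)\<^sup>2 \<le> cnorm B (star B x \<otimes> x)"
      using x closed cnorm_ge_0 by (simp add: real_le_rsqrt sqrt_ge_absD)
    ultimately show "cnorm B (star B x \<otimes> x) = (cnorm B x)\<^sup>2" by simp
  qed (use assms vector_space norm_nonneg norm_eq_0 norm_triangle norm_smult closed in auto)
qed

end

section \<open>Copies of subalgebras on another type\<close>

definition transport :: "'a cstar_algebra \<Rightarrow> 'a set \<Rightarrow> ('a \<Rightarrow> 'b) \<Rightarrow> 'b cstar_algebra"
  where "transport A T c = (let g = the_inv_into T c in
    \<lparr>carrier = c ` T, monoid.mult = \<lambda>x y. c (g x \<otimes>\<^bsub>A\<^esub> g y), one = c \<one>\<^bsub>A\<^esub>, ring.zero = c \<zero>\<^bsub>A\<^esub>,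
     add = \<lambda>x y. c (g x \<oplus>\<^bsub>A\<^esub> g y), module.smult = \<lambda>a x. c (a \<odot>\<^bsub>A\<^esub> g x),
     star = \<lambda>x. c (star A (g x)), cnorm = \<lambda>x. cnorm A (g x)\<rparr>)"

lemma cstar_subalgebraD:
  assumes "cstar_subalgebra A T"
  shows "T \<subseteq> carrier A" "\<zero>\<^bsub>A\<^esub> \<in> T" "x \<in> T \<Longrightarrow> y \<in> T \<Longrightarrow> x \<oplus>\<^bsub>A\<^esub> y \<in> T"
    "x \<in> T \<Longrightarrow> y \<in> T \<Longrightarrow> x \<otimes>\<^bsub>A\<^esub> y \<in> T" "x \<in> T \<Longrightarrow> star A x \<in> T" "x \<in> T \<Longrightarrow> a \<odot>\<^bsub>A\<^esub> x \<in> T"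
    "closedin (norm_topology A (cnorm A)) T"
  using assms by (auto simp: cstar_subalgebra_def)

text \<open>The decoding map \<open>g\<close> alone separates points, so a one-point
  \<open>star_family\<close> yields everything but completeness. For that, \<open>g\<close> moves a
  Cauchy sequence to \<open>A\<close> without changing norms, and the limit stays in the closed set
  \<open>T\<close>.\<close>

lemma transport:
  fixes A :: "'a cstar_algebra" and c :: "'a \<Rightarrow> 'b"
  assumes A: "cstar_algebra A" and T: "cstar_subalgebra A T" and c: "inj_on c T"
  defines "B \<equiv> transport A T c" and "g \<equiv> the_inv_into T c"
  shows "cstar_algebra B" "star_hom B A g" "carrier B = c ` T" "cnorm B x = cnorm A (g x)"
proof -
  interpret A: cstar_algebra A by fact
  have g: "g (c x) = x" if "x \<in> T" for x
    using c that by (simp add: g_def the_inv_into_f_f)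
  note T' = cstar_subalgebraD[OF T]
  have sub: "x \<in> T \<Longrightarrow> x \<in> carrier A" for x using T'(1) by blast
  show car: "carrier B = c ` T" and cn: "cnorm B x = cnorm A (g x)" for x
    by (auto simp: B_def transport_def g_def Let_def)
  show hom: "star_hom B A g"
    using T' sub g by (auto simp: star_hom_def B_def transport_def Let_def simp flip: g_def)
  interpret star_family B "{()}" "\<lambda>_. A" "\<lambda>_. g"
  proof
    show "\<zero>\<^bsub>B\<^esub> \<in> carrier B" "g \<zero>\<^bsub>B\<^esub> = \<zero>\<^bsub>A\<^esub>"
      using T'(2) g by (auto simp: B_def transport_def Let_def)
    fix x assume x: "x \<in> carrier B"
    have "0 \<le> cnorm A (g x)"
      using star_hom_closed[OF hom x] by (rule A.cnorm_nonneg)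
    then show "cnorm B x = Sup (insert 0 ((\<lambda>i. cnorm A (g x)) ` {()}))"
      by (simp add: cn cSup_eq_Max)
    show "star B x \<in> carrier B" "a \<odot>\<^bsub>B\<^esub> x \<in> carrier B" for a
      using x g T' by (auto simp: B_def transport_def Let_def simp flip: g_def)
    fix y assume y: "y \<in> carrier B"
    show "x \<oplus>\<^bsub>B\<^esub> y \<in> carrier B" "x \<otimes>\<^bsub>B\<^esub> y \<in> carrier B"
      using x y g T' by (auto simp: B_def transport_def Let_def simp flip: g_def)
    show "x = y" if "\<And>i. i \<in> {()} \<Longrightarrow> g x = g y"
      using that x y g car by auto
  qed (use A hom in auto)
  interpret B: normed_carrier B "cnorm B" by (rule normed_carrier)
  have diff: "cnorm A (g x \<ominus>\<^bsub>A\<^esub> g y) = cnorm B (x \<ominus>\<^bsub>B\<^esub> y)" if "x \<in> carrier B" "y \<in> carrier B" for x y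
    using that star_homD[OF hom] by (simp add: cn A.minus_conv B.minus_conv)
  have "norm_complete B (cnorm B)"
    unfolding B.norm_complete_iff_tends
  proof (intro allI impI)
    fix f :: "nat \<Rightarrow> 'b" assume f: "range f \<subseteq> carrier B"
      and Cau: "\<forall>e>0. \<exists>N. \<forall>k\<ge>N. \<forall>m\<ge>N. cnorm B (f k \<ominus>\<^bsub>B\<^esub> f m) < e"
    have gf: "g (f k) \<in> T" for k
      using f g car by (force dest: range_subsetD[where i = k])
    have "\<exists>x. tends A (cnorm A) (\<lambda>k. g (f k)) x"
      using gf sub Cau f by (intro A.cstar_complete) (auto simp: diff range_subsetD)
    then obtain x where x: "tends A (cnorm A) (\<lambda>k. g (f k)) x" by blast
    then have "x \<in> T"
      using A.tends_closedin[OF T'(7)] gf by simp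
    then have "c x \<in> carrier B" "g (c x) = x" using car g by auto
    then have "tends B (cnorm B) f (c x)"
      using x f unfolding tends_def by (auto simp: range_subsetD simp flip: diff)
    then show "\<exists>x. tends B (cnorm B) f x" by blast
  qed
  then show "cstar_algebra B" by (rule cstar_algebra)
qed

section \<open>Bounded products of C*-algebras\<close>

definition cstar_prod :: "'i set \<Rightarrow> ('i \<Rightarrow> 'a cstar_algebra) \<Rightarrow> ('i \<Rightarrow> 'a) cstar_algebra"
  where "cstar_prod I A =
    \<lparr>carrier = {f \<in> \<Pi>\<^sub>E i\<in>I. carrier (A i). bdd_above ((\<lambda>i. cnorm (A i) (f i)) ` I)},
     monoid.mult = \<lambda>f g. \<lambda>i\<in>I. f i \<otimes>\<^bsub>A i\<^esub> g i, one = \<lambda>i\<in>I. \<one>\<^bsub>A i\<^esub>, ring.zero = \<lambda>i\<in>I. \<zero>\<^bsub>A i\<^esub>,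
     add = \<lambda>f g. \<lambda>i\<in>I. f i \<oplus>\<^bsub>A i\<^esub> g i, module.smult = \<lambda>a f. \<lambda>i\<in>I. a \<odot>\<^bsub>A i\<^esub> f i,
     star = \<lambda>f. \<lambda>i\<in>I. star (A i) (f i),
     cnorm = \<lambda>f. Sup (insert 0 ((\<lambda>i. cnorm (A i) (f i)) ` I))\<rparr>"

lemma cstar_prod_carrierI:
  assumes "f \<in> (\<Pi>\<^sub>E i\<in>I. carrier (A i))" "\<And>i. i \<in> I \<Longrightarrow> cnorm (A i) (f i) \<le> c"
  shows "f \<in> carrier (cstar_prod I A)"
  using assms by (auto simp: cstar_prod_def intro!: bdd_aboveI2)

lemma star_hom_cstar_prod: "i \<in> I \<Longrightarrow> star_hom (cstar_prod I A) (A i) (\<lambda>f. f i)"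
  by (auto simp: star_hom_def cstar_prod_def)

text \<open>Elements are extensional functions, so the coordinates separate them. The bounds
  \<open>c + d\<close>, \<open>c * d\<close> and \<open>cmod a * c\<close> keep sums, products and
  multiples of bounded families bounded.\<close>

lemma star_family_cstar_prod:
  assumes cstar: "\<And>i. i \<in> I \<Longrightarrow> cstar_algebra (A i)"
  shows "star_family (cstar_prod I A) I A (\<lambda>i f. f i)"
proof (rule star_family.intro)
  let ?B = "cstar_prod I A"
  have bound: "\<exists>c\<ge>0. \<forall>i\<in>I. cnorm (A i) (f i) \<le> c" if "f \<in> carrier ?B" for f
  proof -
    from that obtain c where "\<forall>i\<in>I. cnorm (A i) (f i) \<le> c"
      by (auto simp: cstar_prod_def bdd_above_def)
    \<comment> \<open>For empty \<open>I\<close> an upper bound may be negative, while the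
      monotonicity argument for \<open>c * d\<close> wants nonnegative bounds.\<close>
    then show ?thesis by (intro exI[of _ "max 0 c"]) auto
  qed
  have elem: "f i \<in> carrier (A i)" if "f \<in> carrier ?B" "i \<in> I" for f i
    using that by (auto simp: cstar_prod_def)
  show "\<zero>\<^bsub>?B\<^esub> \<in> carrier ?B"
  proof (rule cstar_prod_carrierI)
    show "\<zero>\<^bsub>?B\<^esub> \<in> (\<Pi>\<^sub>E i\<in>I. carrier (A i))"
      using cstar by (auto simp: cstar_prod_def cstar_algebra_zero)
    show "cnorm (A i) (\<zero>\<^bsub>?B\<^esub> i) \<le> 0" if "i \<in> I" for i
      using that cstar by (simp add: cstar_prod_def cstar_algebra_zero)
  qed
  fix f assume f: "f \<in> carrier ?B"
  from bound[OF f] obtain c where c: "c \<ge> 0" "\<And>i. i \<in> I \<Longrightarrow> cnorm (A i) (f i) \<le> c" by blast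
  show "star ?B f \<in> carrier ?B"
    by (rule cstar_prod_carrierI[where c = c])
      (use f c elem cstar in \<open>auto simp: cstar_prod_def cstar_algebra.cnorm_star cstar_algebra.star_closed\<close>)
  show "a \<odot>\<^bsub>?B\<^esub> f \<in> carrier ?B" for a
  proof (rule cstar_prod_carrierI[where c = "cmod a * c"])
    show "a \<odot>\<^bsub>?B\<^esub> f \<in> (\<Pi>\<^sub>E i\<in>I. carrier (A i))"
      using elem[OF f] cstar
      by (auto simp: cstar_prod_def intro!: complex_vs.smult_carrier complex_vs.intro cstar_algebra.vector_space)
    show "cnorm (A i) ((a \<odot>\<^bsub>?B\<^esub> f) i) \<le> cmod a * c" if "i \<in> I" for i
      using that elem[OF f that] c cstar
      by (simp add: cstar_prod_def cstar_algebra.cnorm_smult mult_left_mono)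
  qed
  show "bdd_above ((\<lambda>i. cnorm (A i) (f i)) ` I)" using f by (simp add: cstar_prod_def)
  show "cnorm ?B f = Sup (insert 0 ((\<lambda>i. cnorm (A i) (f i)) ` I))" by (simp add: cstar_prod_def)
  fix g assume g: "g \<in> carrier ?B"
  from bound[OF g] obtain d where d: "d \<ge> 0" "\<And>i. i \<in> I \<Longrightarrow> cnorm (A i) (g i) \<le> d" by blast
  show "f \<oplus>\<^bsub>?B\<^esub> g \<in> carrier ?B"
  proof (rule cstar_prod_carrierI[where c = "c + d"])
    show "f \<oplus>\<^bsub>?B\<^esub> g \<in> (\<Pi>\<^sub>E i\<in>I. carrier (A i))"
      using elem[OF f] elem[OF g] cstar
      by (auto simp: cstar_prod_def intro!: abelian_monoid.a_closed cstar_algebra.vector_space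
          abelian_group.axioms(1) module.axioms(2))
    show "cnorm (A i) ((f \<oplus>\<^bsub>?B\<^esub> g) i) \<le> c + d" if "i \<in> I" for i
      using that elem[OF f that] elem[OF g that] c(2)[OF that] d(2)[OF that]
        cstar_algebra.cnorm_triangle[OF cstar[OF that], of "f i" "g i"]
      by (simp add: cstar_prod_def)
  qed
  show "f \<otimes>\<^bsub>?B\<^esub> g \<in> carrier ?B"
  proof (rule cstar_prod_carrierI[where c = "c * d"])
    show "f \<otimes>\<^bsub>?B\<^esub> g \<in> (\<Pi>\<^sub>E i\<in>I. carrier (A i))"
      using elem[OF f] elem[OF g] cstar
      by (auto simp: cstar_prod_def intro!: cstar_algebra.mult_closed)
    show "cnorm (A i) ((f \<otimes>\<^bsub>?B\<^esub> g) i) \<le> c * d" if "i \<in> I" for i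
    proof -
      have "cnorm (A i) (f i \<otimes>\<^bsub>A i\<^esub> g i) \<le> cnorm (A i) (f i) * cnorm (A i) (g i)"
        by (rule cstar_algebra.cnorm_mult[OF cstar[OF that] elem[OF f that] elem[OF g that]])
      also have "\<dots> \<le> c * d"
        using c d that cstar_algebra.cnorm_nonneg[OF cstar[OF that] elem[OF g that]]
        by (intro mult_mono) auto
      finally show ?thesis using that by (simp add: cstar_prod_def)
    qed
  qed
  show "f = g" if "\<And>i. i \<in> I \<Longrightarrow> f i = g i"
    using f g that by (auto simp: cstar_prod_def intro: PiE_ext)
next
  show "\<zero>\<^bsub>cstar_prod I A\<^esub> i = \<zero>\<^bsub>A i\<^esub>" if "i \<in> I" for i
    using that by (simp add: cstar_prod_def)
qed (auto simp: cstar star_hom_cstar_prod)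

text \<open>Completeness remains. A Cauchy sequence converges in each coordinate, and since its
  Cauchy condition is uniform in the coordinate, so is the convergence; this bounds the family of
  limits and gives convergence in the supremum norm.\<close>

lemma cstar_algebra_cstar_prod:
  fixes I :: "'i set" and A :: "'i \<Rightarrow> 'a cstar_algebra"
  assumes cstar: "\<And>i. i \<in> I \<Longrightarrow> cstar_algebra (A i)"
  shows "cstar_algebra (cstar_prod I A)"
proof -
  let ?B = "cstar_prod I A"
  interpret star_family ?B I A "\<lambda>i f. f i" by (rule star_family_cstar_prod) fact
  interpret B: normed_carrier ?B "cnorm ?B" by (rule normed_carrier)
  have diff: "(f \<ominus>\<^bsub>?B\<^esub> g) i = f i \<ominus>\<^bsub>A i\<^esub> g i"
    if "f \<in> carrier ?B" "g \<in> carrier ?B" "i \<in> I" for f g i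
  proof -
    interpret cstar_algebra "A i" by (rule cstar) fact
    show ?thesis
      using that by (simp add: B.minus_conv minus_conv hom_simps)
  qed
  have "norm_complete ?B (cnorm ?B)"
    unfolding B.norm_complete_iff_tends
  proof (intro allI impI)
    fix f :: "nat \<Rightarrow> 'i \<Rightarrow> 'a" assume "range f \<subseteq> carrier ?B"
      and Cau: "\<forall>e>0. \<exists>N. \<forall>k\<ge>N. \<forall>m\<ge>N. cnorm ?B (f k \<ominus>\<^bsub>?B\<^esub> f m) < e"
    then have f: "f k \<in> carrier ?B" for k by auto
    have fi: "f k i \<in> carrier (A i)" if "i \<in> I" for i k
      using hom_simps(1)[OF that f] .
    have near: "cnorm (A i) (f k i \<ominus>\<^bsub>A i\<^esub> f m i) \<le> cnorm ?B (f k \<ominus>\<^bsub>?B\<^esub> f m)"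
      if "i \<in> I" for i k m
      using cnorm_hom_le[of "f k \<ominus>\<^bsub>?B\<^esub> f m" i] that f by (simp add: diff)
    have "\<exists>y. tends (A i) (cnorm (A i)) (\<lambda>k. f k i) y" if i: "i \<in> I" for i
    proof (rule cstar_algebra.cstar_complete[OF cstar[OF i]])
      show "range (\<lambda>k. f k i) \<subseteq> carrier (A i)" using fi[OF i] by auto
      show "\<exists>N. \<forall>k\<ge>N. \<forall>m\<ge>N. cnorm (A i) (f k i \<ominus>\<^bsub>A i\<^esub> f m i) < e" if "e > 0" for e
        using Cau that near[OF i] by (meson order_le_less_trans)
    qed
    then obtain l where l: "\<And>i. i \<in> I \<Longrightarrow> tends (A i) (cnorm (A i)) (\<lambda>k. f k i) (l i)"
      by metis
    define x where "x = (\<lambda>i\<in>I. l i)"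
    have li: "l i \<in> carrier (A i)" if "i \<in> I" for i
      using l[OF that] by (simp add: tends_def)
    \<comment> \<open>The auxiliary index \<open>m\<close> may depend on the coordinate
      \<open>i\<close>: it lies beyond \<open>N\<close> and brings \<open>f m i\<close> close to its
      limit, but it does not occur in the resulting bound.\<close>
    have close: "\<exists>N. \<forall>k\<ge>N. \<forall>i\<in>I. cnorm (A i) (f k i \<ominus>\<^bsub>A i\<^esub> l i) \<le> e" if e: "e > 0" for e
    proof -
      have "e/2 > 0" using e by simp
      with Cau obtain N where N: "\<forall>k\<ge>N. \<forall>m\<ge>N. cnorm ?B (f k \<ominus>\<^bsub>?B\<^esub> f m) < e/2"
        by blast
      have "cnorm (A i) (f k i \<ominus>\<^bsub>A i\<^esub> l i) \<le> e" if k: "k \<ge> N" and i: "i \<in> I" for k i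
      proof -
        interpret cstar_algebra "A i" by (rule cstar) fact
        have "(\<lambda>m. cnorm (A i) (f m i \<ominus>\<^bsub>A i\<^esub> l i)) \<longlonglongrightarrow> 0"
          using l[OF i] by (simp add: tends_def)
        then have "\<forall>\<^sub>F m in sequentially. cnorm (A i) (f m i \<ominus>\<^bsub>A i\<^esub> l i) < e/2"
          using e by (intro order_tendstoD(2)) auto
        then obtain m where m: "m \<ge> N" "cnorm (A i) (f m i \<ominus>\<^bsub>A i\<^esub> l i) < e/2"
          unfolding eventually_sequentially by (metis nle_le)
        show ?thesis
          using norm_diff_triangle[OF fi[OF i, of k] fi[OF i, of m] li[OF i]] near[OF i, of k m]
            N[rule_format, OF k m(1)] m(2) by linarith
      qed
      then show ?thesis by blast
    qed
    \<comment> \<open>A single uniformly close term already bounds the coordinates of the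
      limit.\<close>
    obtain N where N: "\<And>i. i \<in> I \<Longrightarrow> cnorm (A i) (f N i \<ominus>\<^bsub>A i\<^esub> l i) \<le> 1"
      using close[of 1] by auto
    have x: "x \<in> carrier ?B"
    proof (rule cstar_prod_carrierI)
      show "x \<in> (\<Pi>\<^sub>E i\<in>I. carrier (A i))" using li by (auto simp: x_def)
      show "cnorm (A i) (x i) \<le> cnorm ?B (f N) + 1" if i: "i \<in> I" for i
      proof -
        interpret cstar_algebra "A i" by (rule cstar) fact
        show ?thesis
          using norm_le_diff[OF li[OF i] fi[OF i, of N]] norm_diff_commute[OF li[OF i] fi[OF i, of N]]
            N[OF i] cnorm_hom_le[OF f i, of N] i by (simp add: x_def)
      qed
    qed
    have "\<exists>N. \<forall>k\<ge>N. cnorm ?B (f k \<ominus>\<^bsub>?B\<^esub> x) < e" if e: "e > 0" for e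
    proof -
      obtain N where N: "\<And>k i. k \<ge> N \<Longrightarrow> i \<in> I \<Longrightarrow> cnorm (A i) (f k i \<ominus>\<^bsub>A i\<^esub> l i) \<le> e/2"
        using close[of "e/2"] e by auto
      have "cnorm ?B (f k \<ominus>\<^bsub>?B\<^esub> x) \<le> e/2" if "k \<ge> N" for k
        using N[OF that] e x f by (subst cnorm_le_iff) (auto simp: diff x_def)
      then show ?thesis using e by (intro exI[of _ N]) force
    qed
    then have "(\<lambda>k. cnorm ?B (f k \<ominus>\<^bsub>?B\<^esub> x)) \<longlonglongrightarrow> 0"
      using B.norm_nonneg x f by (simp add: lim_sequentially)
    then have "tends ?B (cnorm ?B) f x" using x f by (auto simp: tends_def)
    then show "\<exists>x. tends ?B (cnorm ?B) f x" by blast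
  qed
  then show ?thesis by (rule cstar_algebra)
qed

section \<open>Generated C*-algebras\<close>

lemma cstar_subalgebraI:
  assumes "cstar_algebra A" "T \<subseteq> carrier A" "\<zero>\<^bsub>A\<^esub> \<in> T"
    "\<And>x y. x \<in> T \<Longrightarrow> y \<in> T \<Longrightarrow> x \<oplus>\<^bsub>A\<^esub> y \<in> T" "\<And>x y. x \<in> T \<Longrightarrow> y \<in> T \<Longrightarrow> x \<otimes>\<^bsub>A\<^esub> y \<in> T"
    "\<And>x. x \<in> T \<Longrightarrow> star A x \<in> T" "\<And>a x. x \<in> T \<Longrightarrow> a \<odot>\<^bsub>A\<^esub> x \<in> T"
    and closed: "\<And>f x. (\<And>k. f k \<in> T) \<Longrightarrow> tends A (cnorm A) f x \<Longrightarrow> x \<in> T"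
  shows "cstar_subalgebra A T"
proof -
  interpret cstar_algebra A by fact
  have "closedin (norm_topology A (cnorm A)) T"
    unfolding closedin_iff_tends
    using assms(2) closed by (auto simp: image_subset_iff)
  then show ?thesis
    using assms unfolding cstar_subalgebra_def by simp
qed

text \<open>Puts the carrier into the family intersected in \<open>cstar_generated\<close>, so that
  generated sets lie in the carrier.\<close>

lemma cstar_subalgebra_carrier:
  assumes "cstar_algebra A"
  shows "cstar_subalgebra A (carrier A)"
proof -
  interpret cstar_algebra A by fact
  show ?thesis
    by (rule cstar_subalgebraI) (auto simp: cstar_algebra_axioms tends_def)
qed

lemma cstar_generated_subset: "S \<subseteq> cstar_generated A S"
  by (auto simp: cstar_generated_def)

lemma cstar_generated_least: "cstar_subalgebra A T \<Longrightarrow> S \<subseteq> T \<Longrightarrow> cstar_generated A S \<subseteq> T"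
  by (auto simp: cstar_generated_def)

lemma cstar_subalgebra_generated:
  assumes "cstar_algebra A" "S \<subseteq> carrier A"
  shows "cstar_subalgebra A (cstar_generated A S)"
proof (rule cstar_subalgebraI)
  interpret cstar_algebra A by fact
  show "cstar_generated A S \<subseteq> carrier A"
    using cstar_generated_least[OF cstar_subalgebra_carrier] assms by blast
  show "x \<in> cstar_generated A S"
    if "\<And>k. f k \<in> cstar_generated A S" "tends A (cnorm A) f x" for f x
    unfolding cstar_generated_def
  proof (rule InterI)
    fix T assume "T \<in> {T. cstar_subalgebra A T \<and> S \<subseteq> T}"
    then show "x \<in> T"
      using that tends_closedin[OF cstar_subalgebraD(7)] unfolding cstar_generated_def by blast
  qed
qed (use assms in \<open>auto simp: cstar_generated_def cstar_subalgebraD\<close>)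

text \<open>The set where \<open>g\<close> and \<open>h\<close> agree is a C*-subalgebra that
  contains \<open>S\<close>; it is closed because star-homomorphisms are continuous.\<close>

lemma star_hom_eq_on_generated:
  assumes A: "cstar_algebra A" and B: "cstar_algebra B"
    and g: "star_hom A B g" and h: "star_hom A B h"
    and gen: "cstar_generated A S = carrier A" and eq: "\<And>x. x \<in> S \<Longrightarrow> g x = h x"
    and x: "x \<in> carrier A"
  shows "g x = h x"
proof -
  interpret A: cstar_algebra A by fact
  interpret B: cstar_algebra B by fact
  interpret g: cstar_hom A B g by unfold_locales fact
  interpret h: cstar_hom A B h by unfold_locales fact
  have "S \<subseteq> carrier A" using cstar_generated_subset[of S A] gen by simp
  moreover have "cstar_subalgebra A {x \<in> carrier A. g x = h x}"
  proof (rule cstar_subalgebraI)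
    fix f x
    assume f: "\<And>k :: nat. f k \<in> {x \<in> carrier A. g x = h x}" and x: "tends A (cnorm A) f x"
    have "g x = h x"
      using B.tends_unique[OF g.tends_hom[OF x]] h.tends_hom[OF x] f by simp
    then show "x \<in> {x \<in> carrier A. g x = h x}" using A.tends_in[OF x] by simp
  qed (auto simp: A g.hom_simps h.hom_simps)
  ultimately show ?thesis
    using cstar_generated_least[of A "{x \<in> carrier A. g x = h x}" S] gen eq x by blast
qed

text \<open>Let \<open>T'\<close> be a C*-subalgebra of the copy that contains the image of
  \<open>S\<close>. Decoding it gives a C*-subalgebra of \<open>A\<close> containing
  \<open>S\<close>, hence the whole generated algebra; encoding again shows that \<open>T'\<close>
  is everything.\<close>

lemma cstar_generated_transport:
  assumes A: "cstar_algebra A" and S: "S \<subseteq> carrier A"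
    and c: "inj_on c (cstar_generated A S)"
  defines "B \<equiv> transport A (cstar_generated A S) c"
  shows "cstar_generated B (c ` S) = carrier B"
proof (rule antisym)
  define T where "T = cstar_generated A S"
  define g where "g = the_inv_into T c"
  have T: "cstar_subalgebra A T" "inj_on c T" "S \<subseteq> T"
    using cstar_subalgebra_generated[OF A S] c cstar_generated_subset[of S A] by (simp_all add: T_def)
  note B = transport[OF A T(1,2), folded B_def[folded T_def] g_def]
  have g: "g (c x) = x" if "x \<in> T" for x
    using T(2) that by (simp add: g_def the_inv_into_f_f)
  interpret A: cstar_algebra A by fact
  interpret B: cstar_algebra B by (rule B)
  interpret g: cstar_hom B A g by unfold_locales (rule B)
  show "cstar_generated B (c ` S) \<subseteq> carrier B"
    using cstar_generated_least[OF cstar_subalgebra_carrier[OF B(1)], of "c ` S"] B(3) T(3)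
    by (simp add: image_mono)
  show "carrier B \<subseteq> cstar_generated B (c ` S)"
    unfolding cstar_generated_def
  proof (rule Inter_greatest)
    fix T' assume "T' \<in> {T'. cstar_subalgebra B T' \<and> c ` S \<subseteq> T'}"
    then have T': "cstar_subalgebra B T'" "c ` S \<subseteq> T'" by auto
    note T'D = cstar_subalgebraD[OF T'(1)]
    have T'B: "x \<in> carrier B" if "x \<in> T'" for x using that T'D(1) by blast
    have "cstar_subalgebra A (g ` T')"
    proof (rule cstar_subalgebraI)
      show "\<zero>\<^bsub>A\<^esub> \<in> g ` T'"
        using T'D(2) g.hom_zero by (metis imageI)
      fix x assume "x \<in> g ` T'"
      then obtain u where u: "u \<in> T'" "x = g u" by blast
      show "star A x \<in> g ` T'" "a \<odot>\<^bsub>A\<^esub> x \<in> g ` T'" for a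
        using u T'D(5,6)[OF u(1)] T'B by (auto simp flip: g.hom_simps)
      fix y assume "y \<in> g ` T'"
      then obtain v where v: "v \<in> T'" "y = g v" by blast
      show "x \<oplus>\<^bsub>A\<^esub> y \<in> g ` T'" "x \<otimes>\<^bsub>A\<^esub> y \<in> g ` T'"
        using u v T'D(3,4)[OF u(1) v(1)] T'B by (auto simp flip: g.hom_simps)
    next
      \<comment> \<open>Closedness: the limit stays in the closed set \<open>T\<close>, so it has a
        code. Decoding preserves norms, so the codes \<open>c (f k)\<close> in \<open>T'\<close>
        converge to \<open>c x\<close>, which the closed set \<open>T'\<close> contains.\<close>
      fix f x assume f: "\<And>k :: nat. f k \<in> g ` T'" and x: "tends A (cnorm A) f x"
      have "g ` T' \<subseteq> T"
        using T'D(1) B(3) g by auto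
      then have fT: "f k \<in> T" for k using f by blast
      then have xT: "x \<in> T"
        using A.tends_closedin[OF cstar_subalgebraD(7)[OF T(1)] x] by simp
      have "c (f k) \<in> T'" for k
        using f[of k] T'D(1) B(3) g by auto
      moreover have "tends B (cnorm B) (\<lambda>k. c (f k)) (c x)"
      proof (rule B.tendsI)
        show "cnorm B (c (f k) \<ominus>\<^bsub>B\<^esub> c x) \<le> cnorm A (f k \<ominus>\<^bsub>A\<^esub> x)" for k
          using fT xT B(3) g by (simp add: B(4) g.hom_diff)
        show "(\<lambda>k. cnorm A (f k \<ominus>\<^bsub>A\<^esub> x)) \<longlonglongrightarrow> 0"
          using x by (simp add: tends_def)
      qed (use fT xT B(3) in auto)
      ultimately have "c x \<in> T'"
        using B.tends_closedin[OF T'D(7)] by blast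
      then show "x \<in> g ` T'" using g[OF xT] by force
    qed (use A T'B in auto)
    moreover have "S \<subseteq> g ` T'"
      using T'(2) T(3) g by force
    ultimately have "T \<subseteq> g ` T'"
      unfolding T_def by (rule cstar_generated_least)
    then have "c ` T \<subseteq> c ` g ` T'" by blast
    also have "c ` g ` T' \<subseteq> T'"
      using T'D(1) B(3) g by auto
    finally show "carrier B \<subseteq> T'" by (simp add: B(3))
  qed
qed

text \<open>For infinite \<open>F\<close> both sums are zero by convention.\<close>

lemma (in cstar_hom) hom_finsum:
  "f \<in> F \<rightarrow> carrier A \<Longrightarrow> h (finsum A f F) = finsum B (\<lambda>x. h (f x)) F"
proof (induction F rule: infinite_finite_induct)
  case (insert x F)
  then have "f x \<in> carrier A" "f \<in> F \<rightarrow> carrier A" "(\<lambda>x. h (f x)) \<in> F \<rightarrow> carrier B"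
    by (auto simp: Pi_iff)
  then show ?case
    using insert by (simp add: A.M.finsum_insert B.M.finsum_insert A.M.finsum_closed hom_simps)
qed (simp_all add: A.M.finsum_infinite B.M.finsum_infinite A.M.finsum_empty B.M.finsum_empty)

section \<open>Representations of product systems\<close>

lemma representationD:
  assumes "representation E p H B \<phi>"
  shows representation_closed: "x \<in> carrier E \<Longrightarrow> \<phi> x \<in> carrier B"
    and representation_mult: "x \<in> carrier E \<Longrightarrow> y \<in> carrier E \<Longrightarrow> \<phi> (x \<otimes>\<^bsub>E\<^esub> y) = \<phi> x \<otimes>\<^bsub>B\<^esub> \<phi> y"
    and representation_ip: "x \<in> carrier E \<Longrightarrow> y \<in> carrier E \<Longrightarrow> p x = p y \<Longrightarrow>
      star B (\<phi> y) \<otimes>\<^bsub>B\<^esub> \<phi> x = ip (H (p x)) x y \<odot>\<^bsub>B\<^esub> \<phi> \<one>\<^bsub>E\<^esub>"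
  using assms by (auto simp: representation_def)

context product_system
begin

sublocale E: Group.monoid E by (rule monoid_E)
sublocale P: Group.monoid P by (rule monoid_P)

lemma onb_carrier: "t \<in> carrier P \<Longrightarrow> orthonormal_basis (H t) F \<Longrightarrow> x \<in> F \<Longrightarrow> x \<in> carrier E"
  using carrier_fibre[of t] by (auto simp: orthonormal_basis_def)

lemma fibre_vs: "t \<in> carrier P \<Longrightarrow> complex_vs (H t)"
  by (intro complex_vs.intro hilbert_space.vector_space hilbert_fibre)

text \<open>Membership in \<open>hom\<close> does not mention units. Applying \<open>p\<close> to
  \<open>1 z = z\<close>, for an element \<open>z\<close> over the identity of \<open>P\<close>,
  isolates \<open>p 1\<close>.\<close>

lemma p_one [simp]: "p \<one>\<^bsub>E\<^esub> = \<one>\<^bsub>P\<^esub>"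
proof -
  interpret complex_vs "H \<one>\<^bsub>P\<^esub>" by (rule fibre_vs) simp
  have z: "\<zero>\<^bsub>H \<one>\<^bsub>P\<^esub>\<^esub> \<in> carrier E" "p \<zero>\<^bsub>H \<one>\<^bsub>P\<^esub>\<^esub> = \<one>\<^bsub>P\<^esub>"
    using M.zero_closed carrier_fibre[of "\<one>\<^bsub>P\<^esub>"] by auto
  have "p \<one>\<^bsub>E\<^esub> \<in> carrier P" using hom_p by (auto simp: hom_def)
  moreover have "p (\<one>\<^bsub>E\<^esub> \<otimes>\<^bsub>E\<^esub> \<zero>\<^bsub>H \<one>\<^bsub>P\<^esub>\<^esub>) = p \<one>\<^bsub>E\<^esub> \<otimes>\<^bsub>P\<^esub> \<one>\<^bsub>P\<^esub>"
    using z by (subst hom_mult[OF hom_p]) simp_all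
  ultimately show ?thesis using z by simp
qed

lemma one_fibre: "\<one>\<^bsub>E\<^esub> \<in> carrier (H \<one>\<^bsub>P\<^esub>)"
  by (simp add: carrier_fibre)

text \<open>Multiplication is isometric, so \<open>1 u = u\<close> gives
  \<open>(u | u) = (1 | 1) (u | u)\<close> with a nonzero factor \<open>(u | u)\<close>.\<close>

lemma ip_one_one: "ip (H \<one>\<^bsub>P\<^esub>) \<one>\<^bsub>E\<^esub> \<one>\<^bsub>E\<^esub> = 1"
proof -
  interpret hilbert_space "H \<one>\<^bsub>P\<^esub>" by (rule hilbert_fibre) simp
  interpret tensor_unitary "H \<one>\<^bsub>P\<^esub>" "H \<one>\<^bsub>P\<^esub>" "H \<one>\<^bsub>P\<^esub>" "\<lambda>x y. x \<otimes>\<^bsub>E\<^esub> y"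
    using tensor_fibres[of "\<one>\<^bsub>P\<^esub>" "\<one>\<^bsub>P\<^esub>"] by simp
  obtain u where u: "u \<in> carrier (H \<one>\<^bsub>P\<^esub>)" "u \<noteq> \<zero>\<^bsub>H \<one>\<^bsub>P\<^esub>\<^esub>"
    using one_dim_fibre by (auto simp: one_dim_def)
  then have "\<one>\<^bsub>E\<^esub> \<otimes>\<^bsub>E\<^esub> u = u" by (simp add: carrier_fibre)
  then have "ip (H \<one>\<^bsub>P\<^esub>) u u = ip (H \<one>\<^bsub>P\<^esub>) \<one>\<^bsub>E\<^esub> \<one>\<^bsub>E\<^esub> * ip (H \<one>\<^bsub>P\<^esub>) u u"
    using isometric[OF one_fibre one_fibre u(1) u(1)] by simp
  then show ?thesis using ip_definite u by auto
qed

text \<open>Complex numbers embedded in the fibre over the identity. They let a word absorb a scalar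
  factor as one more letter.\<close>

definition scalar :: "complex \<Rightarrow> 'e"
  where "scalar a = a \<odot>\<^bsub>H \<one>\<^bsub>P\<^esub>\<^esub> \<one>\<^bsub>E\<^esub>"

lemma scalar_closed: "scalar a \<in> carrier E" and p_scalar: "p (scalar a) = \<one>\<^bsub>P\<^esub>"
proof -
  interpret complex_vs "H \<one>\<^bsub>P\<^esub>" by (rule fibre_vs) simp
  have "scalar a \<in> carrier (H \<one>\<^bsub>P\<^esub>)"
    unfolding scalar_def using one_fibre by blast
  then show "scalar a \<in> carrier E" "p (scalar a) = \<one>\<^bsub>P\<^esub>"
    by (auto simp: carrier_fibre)
qed

lemma ip_scalar_one: "ip (H \<one>\<^bsub>P\<^esub>) (scalar a) \<one>\<^bsub>E\<^esub> = a"
  using hilbert_space.ip_smult_left[OF hilbert_fibre one_fibre one_fibre] ip_one_one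
  by (simp add: scalar_def)

lemma cuntz_representation_cong:
  assumes B: "cstar_algebra B" and \<phi>: "cuntz_representation P E p H B \<phi>"
    and eq: "\<And>x. x \<in> carrier E \<Longrightarrow> \<psi> x = \<phi> x"
  shows "cuntz_representation P E p H B \<psi>"
proof -
  interpret B: cstar_algebra B by fact
  have rep: "representation E p H B \<phi>" and
    sum: "\<And>t F. t \<in> carrier P \<Longrightarrow> orthonormal_basis (H t) F \<Longrightarrow>
      finsum B (\<lambda>f. \<phi> f \<otimes>\<^bsub>B\<^esub> star B (\<phi> f)) F = \<phi> \<one>\<^bsub>E\<^esub>"
    using \<phi> by (auto simp: cuntz_representation_def)
  note r = representationD[OF rep]
  show ?thesis
    unfolding cuntz_representation_def representation_def
  proof (intro conjI ballI allI impI)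
    fix t F assume t: "t \<in> carrier P" and F: "orthonormal_basis (H t) F"
    note Fc = onb_carrier[OF t F]
    have "finsum B (\<lambda>f. \<psi> f \<otimes>\<^bsub>B\<^esub> star B (\<psi> f)) F = finsum B (\<lambda>f. \<phi> f \<otimes>\<^bsub>B\<^esub> star B (\<phi> f)) F"
      using Fc eq r(1) by (intro B.M.finsum_cong') auto
    then show "finsum B (\<lambda>f. \<psi> f \<otimes>\<^bsub>B\<^esub> star B (\<psi> f)) F = \<psi> \<one>\<^bsub>E\<^esub>"
      by (simp add: sum[OF t F] eq)
  qed (use r eq in auto)
qed

text \<open>The relations of a Cuntz representation are equations in the algebra, so a separating
  family of star-homomorphisms detects them. This serves both for the coordinates of a product and
  for an injective decoding map.\<close>

lemma cuntz_representation_separating: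
  assumes A: "cstar_algebra A" and B: "\<And>i. i \<in> I \<Longrightarrow> cstar_algebra (B i)"
    and hom: "\<And>i. i \<in> I \<Longrightarrow> star_hom A (B i) (\<rho> i)"
    and separating: "\<And>x y. \<lbrakk>x \<in> carrier A; y \<in> carrier A; \<And>i. i \<in> I \<Longrightarrow> \<rho> i x = \<rho> i y\<rbrakk> \<Longrightarrow> x = y"
    and \<phi>: "\<And>x. x \<in> carrier E \<Longrightarrow> \<phi> x \<in> carrier A"
    and cuntz: "\<And>i. i \<in> I \<Longrightarrow> cuntz_representation P E p H (B i) (\<lambda>x. \<rho> i (\<phi> x))"
  shows "cuntz_representation P E p H A \<phi>"
  unfolding cuntz_representation_def representation_def
proof (intro conjI ballI allI impI)
  interpret A: cstar_algebra A by fact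
  have rep: "representation E p H (B i) (\<lambda>x. \<rho> i (\<phi> x))" if "i \<in> I" for i
    using cuntz[OF that] by (simp add: cuntz_representation_def)
  note r = representationD[OF rep]
  {
    fix t F assume t: "t \<in> carrier P" and F: "orthonormal_basis (H t) F"
    note Fc = onb_carrier[OF t F]
    show "finsum A (\<lambda>f. \<phi> f \<otimes>\<^bsub>A\<^esub> star A (\<phi> f)) F = \<phi> \<one>\<^bsub>E\<^esub>"
    proof (rule separating)
      fix i assume i: "i \<in> I"
      interpret B: cstar_algebra "B i" by (rule B[OF i])
      interpret cstar_hom A "B i" "\<rho> i" by unfold_locales (rule hom[OF i])
      have "\<rho> i (finsum A (\<lambda>f. \<phi> f \<otimes>\<^bsub>A\<^esub> star A (\<phi> f)) F)
          = finsum (B i) (\<lambda>f. \<rho> i (\<phi> f) \<otimes>\<^bsub>B i\<^esub> star (B i) (\<rho> i (\<phi> f))) F"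
        using Fc \<phi> by (subst hom_finsum) (auto simp: hom_simps intro!: B.M.finsum_cong')
      also have "\<dots> = \<rho> i (\<phi> \<one>\<^bsub>E\<^esub>)"
        using cuntz[OF i] t F by (simp add: cuntz_representation_def)
      finally show "\<rho> i (finsum A (\<lambda>f. \<phi> f \<otimes>\<^bsub>A\<^esub> star A (\<phi> f)) F) = \<rho> i (\<phi> \<one>\<^bsub>E\<^esub>)" .
    qed (use Fc \<phi> in \<open>auto intro!: A.M.finsum_closed\<close>)
  }
  fix x y assume x: "x \<in> carrier E" and y: "y \<in> carrier E"
  show "\<phi> (x \<otimes>\<^bsub>E\<^esub> y) = \<phi> x \<otimes>\<^bsub>A\<^esub> \<phi> y"
    using x y \<phi> r(2) by (intro separating) (auto simp: star_homD[OF hom])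
  assume "p x = p y"
  then show "star A (\<phi> y) \<otimes>\<^bsub>A\<^esub> \<phi> x = ip (H (p x)) x y \<odot>\<^bsub>A\<^esub> \<phi> \<one>\<^bsub>E\<^esub>"
    using x y \<phi> r(3) by (intro separating) (auto simp: star_homD[OF hom])
qed (use \<phi> in auto)

end

section \<open>A single representation: norm bound, sums of words, and codes\<close>

locale product_system_rep = product_system P E p H + B: cstar_algebra B
  for P :: "'p monoid" and E :: "'e monoid" and p :: "'e \<Rightarrow> 'p" and H :: "'p \<Rightarrow> 'e hilbert_space"
    and B :: "'b cstar_algebra" +
  fixes \<phi> :: "'e \<Rightarrow> 'b"
  assumes rep: "representation E p H B \<phi>"
begin

lemmas rep_simps = representationD[OF rep]
declare rep_simps(1) [simp]

text \<open>A projection that acts as a unit on the words below, while \<open>B\<close> itself may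
  have another unit or none.\<close>

definition e where "e = \<phi> \<one>\<^bsub>E\<^esub>"

lemma e_closed [simp]: "e \<in> carrier B"
  by (simp add: e_def)

lemma e_star_e: "star B e \<otimes>\<^bsub>B\<^esub> e = e"
  using rep_simps(3)[of "\<one>\<^bsub>E\<^esub>" "\<one>\<^bsub>E\<^esub>"] by (simp add: e_def ip_one_one)

lemma star_e [simp]: "star B e = e"
  using B.star_mult[of "star B e" e] by (simp add: e_star_e)

lemma e_mult_rep [simp]: "x \<in> carrier E \<Longrightarrow> e \<otimes>\<^bsub>B\<^esub> \<phi> x = \<phi> x"
  using rep_simps(2)[of "\<one>\<^bsub>E\<^esub>" x] by (simp add: e_def)

lemma e_mult_star_rep [simp]: "x \<in> carrier E \<Longrightarrow> e \<otimes>\<^bsub>B\<^esub> star B (\<phi> x) = star B (\<phi> x)"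
  using rep_simps(2)[of x "\<one>\<^bsub>E\<^esub>"] B.star_mult[of "\<phi> x" e] by (simp add: e_def[symmetric])

text \<open>The inner product relation with second vector 1 gives
  \<open>e \<phi>(scalar a) = a e\<close>, and \<open>e\<close> is absorbed on the left.\<close>

lemma rep_scalar: "\<phi> (scalar a) = a \<odot>\<^bsub>B\<^esub> e"
  using rep_simps(3)[of "scalar a" "\<one>\<^bsub>E\<^esub>"] e_mult_rep[of "scalar a"]
  by (simp add: e_def[symmetric] scalar_closed p_scalar ip_scalar_one)

text \<open>The projection \<open>e\<close> has norm at most 1, and
  \<open>star B (\<phi> x) \<otimes> \<phi> x\<close> is a multiple of it. The bound mentions
  neither \<open>B\<close> nor \<open>\<phi>\<close>, so arbitrary families of representations are
  bounded at each \<open>x\<close>.\<close>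

lemma cnorm_rep_le:
  assumes x: "x \<in> carrier E"
  shows "cnorm B (\<phi> x) \<le> sqrt (cmod (ip (H (p x)) x x))"
proof -
  have "(cnorm B e)\<^sup>2 = cnorm B e"
    using B.cstar_identity[of e] by (simp add: e_star_e del: star_e)
  then have "cnorm B e \<le> 1"
    by (auto simp: power2_eq_square)
  moreover have "(cnorm B (\<phi> x))\<^sup>2 = cmod (ip (H (p x)) x x) * cnorm B e"
    using B.cstar_identity[of "\<phi> x"] rep_simps(3)[of x x] x by (simp add: B.cnorm_smult flip: e_def)
  ultimately show ?thesis
    by (intro real_le_rsqrt) (simp add: mult_left_le)
qed

definition letter :: "'e \<times> bool \<Rightarrow> 'b"
  where "letter l = (if snd l then star B (\<phi> (fst l)) else \<phi> (fst l))"

text \<open>The fold starts at \<open>e\<close>, which stands in for a unit.\<close>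

definition wval :: "('e \<times> bool) list \<Rightarrow> 'b"
  where "wval w = foldr (\<lambda>l z. letter l \<otimes>\<^bsub>B\<^esub> z) w e"

definition sval :: "('e \<times> bool) list list \<Rightarrow> 'b"
  where "sval s = foldr (\<lambda>w z. wval w \<oplus>\<^bsub>B\<^esub> z) s \<zero>\<^bsub>B\<^esub>"

abbreviation "words \<equiv> lists (carrier E \<times> (UNIV :: bool set))"

lemma letter_closed [simp]: "l \<in> carrier E \<times> UNIV \<Longrightarrow> letter l \<in> carrier B"
  by (auto simp: letter_def)

lemma wval_simps [simp]: "wval [] = e" "wval (l # w) = letter l \<otimes>\<^bsub>B\<^esub> wval w"
  by (simp_all add: wval_def)

lemma sval_simps [simp]: "sval [] = \<zero>\<^bsub>B\<^esub>" "sval (w # s) = wval w \<oplus>\<^bsub>B\<^esub> sval s"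
  by (simp_all add: sval_def)

lemma wval_closed [simp]: "w \<in> words \<Longrightarrow> wval w \<in> carrier B"
  by (induction w) auto

lemma sval_closed [simp]: "s \<in> lists words \<Longrightarrow> sval s \<in> carrier B"
  by (induction s) auto

lemma e_mult_letter: "l \<in> carrier E \<times> UNIV \<Longrightarrow> e \<otimes>\<^bsub>B\<^esub> letter l = letter l"
  by (auto simp: letter_def)

lemma e_mult_wval: "w \<in> words \<Longrightarrow> e \<otimes>\<^bsub>B\<^esub> wval w = wval w"
  by (cases w) (use e_star_e in \<open>auto simp: e_mult_letter simp flip: B.mult_assoc\<close>)

lemma wval_append: "v \<in> words \<Longrightarrow> w \<in> words \<Longrightarrow> wval (v @ w) = wval v \<otimes>\<^bsub>B\<^esub> wval w"
  by (induction v) (auto simp: e_mult_wval B.mult_assoc)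

lemma sval_append: "s \<in> lists words \<Longrightarrow> t \<in> lists words \<Longrightarrow> sval (s @ t) = sval s \<oplus>\<^bsub>B\<^esub> sval t"
  by (induction s) (auto simp: B.M.a_assoc)

lemma wval_mult_sval:
  "w \<in> words \<Longrightarrow> t \<in> lists words \<Longrightarrow> wval w \<otimes>\<^bsub>B\<^esub> sval t = sval (map ((@) w) t)"
  by (induction t) (auto simp: B.distrib_left wval_append)

lemma map_append_words: "w \<in> words \<Longrightarrow> t \<in> lists words \<Longrightarrow> map ((@) w) t \<in> lists words"
  by (induction t) auto

lemma concat_words:
  "s \<in> lists words \<Longrightarrow> t \<in> lists words \<Longrightarrow> concat (map (\<lambda>w. map ((@) w) t) s) \<in> lists words"
  by (induction s) (simp_all add: map_append_words)

lemma flip_words: "w \<in> words \<Longrightarrow> rev (map (\<lambda>l. (fst l, \<not> snd l)) w) \<in> words"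
  by (induction w) auto

lemma sval_mult:
  "s \<in> lists words \<Longrightarrow> t \<in> lists words \<Longrightarrow>
    sval s \<otimes>\<^bsub>B\<^esub> sval t = sval (concat (map (\<lambda>w. map ((@) w) t) s))"
  by (induction s) (simp_all add: B.distrib_right wval_mult_sval sval_append map_append_words concat_words)

lemma star_letter: "l \<in> carrier E \<times> UNIV \<Longrightarrow> star B (letter l) = letter (fst l, \<not> snd l)"
  by (auto simp: letter_def)

lemma star_wval: "w \<in> words \<Longrightarrow> star B (wval w) = wval (rev (map (\<lambda>l. (fst l, \<not> snd l)) w))"
proof (induction w)
  case (Cons l w)
  \<comment> \<open>Reversal moves this letter to the end, where \<open>wval\<close> multiplies it
    by \<open>e\<close> from the right.\<close>
  have "letter (fst l, \<not> snd l) \<otimes>\<^bsub>B\<^esub> e = letter (fst l, \<not> snd l)"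
    using Cons.prems rep_simps(2)[of "fst l" "\<one>\<^bsub>E\<^esub>"] B.star_mult[of e "\<phi> (fst l)"]
    by (auto simp: letter_def simp flip: e_def)
  moreover have "w \<in> words" "l \<in> carrier E \<times> UNIV" "(fst l, \<not> snd l) \<in> carrier E \<times> UNIV"
    using Cons.prems by auto
  ultimately show ?case
    using Cons.IH flip_words[of w] by (simp add: B.star_mult star_letter wval_append)
qed simp

lemma star_sval:
  "s \<in> lists words \<Longrightarrow> star B (sval s) = sval (map (\<lambda>w. rev (map (\<lambda>l. (fst l, \<not> snd l)) w)) s)"
  by (induction s) (auto simp: B.star_add star_wval)

text \<open>By \<open>rep_scalar\<close> the new letter contributes \<open>a \<odot> e\<close>, and
  \<open>e\<close> is absorbed by the word.\<close>

lemma smult_wval: "w \<in> words \<Longrightarrow> a \<odot>\<^bsub>B\<^esub> wval w = wval ((scalar a, False) # w)"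
  by (simp add: letter_def rep_scalar B.smult_mult_left e_mult_wval)

lemma smult_sval: "s \<in> lists words \<Longrightarrow> a \<odot>\<^bsub>B\<^esub> sval s = sval (map ((#) (scalar a, False)) s)"
  by (induction s) (auto simp: B.smult_add_right smult_wval simp del: wval_simps(2))

definition word_sums where "word_sums = sval ` lists words"

lemma word_sums_closed: "d \<in> word_sums \<Longrightarrow> d \<in> carrier B"
  unfolding word_sums_def by (elim imageE) simp

text \<open>The closure is described by sequences because such a sequence of word sums is what
  becomes the code of its limit.\<close>

definition word_closure where
  "word_closure = {x. \<exists>f. (\<forall>k. f k \<in> word_sums) \<and> tends B (cnorm B) f x}"

lemma word_closureI:
  "(\<And>k. f k \<in> word_sums) \<Longrightarrow> tends B (cnorm B) f x \<Longrightarrow> x \<in> word_closure"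
  unfolding word_closure_def by blast

lemma word_sums_ops:
  assumes "d \<in> word_sums" "d' \<in> word_sums"
  shows "d \<oplus>\<^bsub>B\<^esub> d' \<in> word_sums" "d \<otimes>\<^bsub>B\<^esub> d' \<in> word_sums" "star B d \<in> word_sums" "a \<odot>\<^bsub>B\<^esub> d \<in> word_sums"
proof -
  from assms obtain s t where s: "s \<in> lists words" "d = sval s" and t: "t \<in> lists words" "d' = sval t"
    unfolding word_sums_def by blast
  have cc: "concat (map (\<lambda>w. map ((@) w) t) s) \<in> lists words"
    using s(1) t(1) by (rule concat_words)
  have "s @ t \<in> lists words" using s(1) t(1) by auto
  then show "d \<oplus>\<^bsub>B\<^esub> d' \<in> word_sums" "d \<otimes>\<^bsub>B\<^esub> d' \<in> word_sums"
    using s t cc by (auto simp: word_sums_def sval_mult simp flip: sval_append)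
  have "map (\<lambda>w. rev (map (\<lambda>l. (fst l, \<not> snd l)) w)) s \<in> lists words"
    using s(1) flip_words by (induction s) auto
  then show "star B d \<in> word_sums"
    using s by (auto simp: word_sums_def star_sval)
  have "map ((#) (scalar a, False)) s \<in> lists words"
    using s(1) scalar_closed by (induction s) auto
  then show "a \<odot>\<^bsub>B\<^esub> d \<in> word_sums"
    using s by (auto simp: word_sums_def smult_sval)
qed

lemma word_sums_subset_closure: "word_sums \<subseteq> word_closure"
  by (intro subsetI word_closureI[OF _ B.tends_const[OF word_sums_closed]])

lemma rep_in_word_sums: "x \<in> carrier E \<Longrightarrow> \<phi> x \<in> word_sums"
proof -
  assume x: "x \<in> carrier E"
  have "sval [[(x, False)]] = \<phi> x"
    using x rep_simps(2)[of x "\<one>\<^bsub>E\<^esub>"] by (simp add: letter_def flip: e_def)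
  moreover have "[[(x, False)]] \<in> lists words" using x by simp
  ultimately show ?thesis unfolding word_sums_def by (metis imageI)
qed

lemma cstar_subalgebra_word_closure: "cstar_subalgebra B word_closure"
proof (rule cstar_subalgebraI)
  show "cstar_algebra B" by (rule B.cstar_algebra_axioms)
  show sub: "word_closure \<subseteq> carrier B"
    by (auto simp: word_closure_def tends_def)
  have "\<zero>\<^bsub>B\<^esub> \<in> word_sums"
    unfolding word_sums_def by (rule image_eqI[of _ _ "[]"]) auto
  then show "\<zero>\<^bsub>B\<^esub> \<in> word_closure" using word_sums_subset_closure by blast
  fix x assume "x \<in> word_closure"
  then obtain f where f: "\<And>k. f k \<in> word_sums" "tends B (cnorm B) f x"
    unfolding word_closure_def by blast
  show "star B x \<in> word_closure"
    by (rule word_closureI[OF word_sums_ops(3)[OF f(1) f(1)] B.tends_star[OF f(2)]])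
  show "a \<odot>\<^bsub>B\<^esub> x \<in> word_closure" for a
    by (rule word_closureI[OF word_sums_ops(4)[OF f(1) f(1)] B.tends_smult[OF f(2)]])
  fix y assume "y \<in> word_closure"
  then obtain g where g: "\<And>k. g k \<in> word_sums" "tends B (cnorm B) g y"
    unfolding word_closure_def by blast
  show "x \<oplus>\<^bsub>B\<^esub> y \<in> word_closure"
    by (rule word_closureI[OF word_sums_ops(1)[OF f(1) g(1)] B.tends_add[OF f(2) g(2)]])
  show "x \<otimes>\<^bsub>B\<^esub> y \<in> word_closure"
    by (rule word_closureI[OF word_sums_ops(2)[OF f(1) g(1)] B.tends_mult[OF f(2) g(2)]])
next
  fix f x assume f: "\<And>k :: nat. f k \<in> word_closure" and x: "tends B (cnorm B) f x"
  \<comment> \<open>Diagonal choice: every \<open>f k\<close> is itself a limit of word sums, one of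
    which lies within \<open>1 / real (Suc k)\<close> of it.\<close>
  have "\<exists>d\<in>word_sums. cnorm B (d \<ominus>\<^bsub>B\<^esub> f k) < 1 / real (Suc k)" for k
  proof -
    from f[of k] obtain g where g: "\<And>m :: nat. g m \<in> word_sums" "tends B (cnorm B) g (f k)"
      unfolding word_closure_def by blast
    from g(2) have "(\<lambda>m. cnorm B (g m \<ominus>\<^bsub>B\<^esub> f k)) \<longlonglongrightarrow> 0" by (simp add: tends_def)
    then have "\<forall>\<^sub>F m in sequentially. cnorm B (g m \<ominus>\<^bsub>B\<^esub> f k) < 1 / real (Suc k)"
      by (rule order_tendstoD(2)) simp
    then obtain m where "cnorm B (g m \<ominus>\<^bsub>B\<^esub> f k) < 1 / real (Suc k)"
      unfolding eventually_sequentially by blast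
    then show ?thesis using g(1) by blast
  qed
  then obtain d where d: "\<And>k. d k \<in> word_sums" "\<And>k. cnorm B (d k \<ominus>\<^bsub>B\<^esub> f k) < 1 / real (Suc k)"
    by metis
  note [simp] = word_sums_closed[OF d(1)] B.tends_in[OF x]
  have "tends B (cnorm B) d x"
  proof (rule B.tendsI)
    show "cnorm B (d k \<ominus>\<^bsub>B\<^esub> x) \<le> 1 / real (Suc k) + cnorm B (f k \<ominus>\<^bsub>B\<^esub> x)" for k
      using B.norm_diff_triangle[of "d k" "f k" x] d(2)[of k] by simp
    have "(\<lambda>k. 1 / real (Suc k) + cnorm B (f k \<ominus>\<^bsub>B\<^esub> x)) \<longlonglongrightarrow> 0 + 0"
      using x by (intro tendsto_add lim_1_over_n[THEN LIMSEQ_Suc]) (simp add: tends_def)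
    then show "(\<lambda>k. 1 / real (Suc k) + cnorm B (f k \<ominus>\<^bsub>B\<^esub> x)) \<longlonglongrightarrow> 0" by simp
  qed simp_all
  then show "x \<in> word_closure" by (rule word_closureI[OF d(1)])
qed

text \<open>Choose for each element a sequence of formal word sums whose values converge to it;
  uniqueness of limits makes the choice injective on the closure, which contains the generated
  algebra.\<close>

lemma ex_code: "\<exists>c :: 'b \<Rightarrow> 'e code. inj_on c (cstar_generated B (\<phi> ` carrier E))"
proof -
  have "\<phi> ` carrier E \<subseteq> word_closure"
    using rep_in_word_sums word_sums_subset_closure by blast
  then have sub: "cstar_generated B (\<phi> ` carrier E) \<subseteq> word_closure"
    by (rule cstar_generated_least[OF cstar_subalgebra_word_closure])
  have "\<exists>s :: 'e code. tends B (cnorm B) (\<lambda>k. sval (s k)) x" if x: "x \<in> word_closure" for x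
  proof -
    from x obtain f where f: "\<And>k. \<exists>s. f k = sval s" "tends B (cnorm B) f x"
      unfolding word_closure_def word_sums_def by blast
    from f(1) obtain s where "\<And>k. f k = sval (s k)" by metis
    then have "f = (\<lambda>k. sval (s k))" by blast
    then show ?thesis using f(2) by blast
  qed
  then obtain c :: "'b \<Rightarrow> 'e code" where
    c: "\<And>x. x \<in> word_closure \<Longrightarrow> tends B (cnorm B) (\<lambda>k. sval (c x k)) x"
    by metis
  have "inj_on c word_closure"
  proof (rule inj_onI)
    fix x y assume "x \<in> word_closure" "y \<in> word_closure" "c x = c y"
    then show "x = y" using c[of x] c[of y] B.tends_unique by simp
  qed
  then show ?thesis using sub inj_on_subset by blast
qed

end

section \<open>Existence, change of type, and uniqueness of the universal pair\<close>

context product_system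
begin

text \<open>The algebra generated by the image of \<open>\<phi>\<close> is copied to the type of
  codes, and \<open>g\<close> undoes the copying. It reaches just this generated subalgebra of
  \<open>B\<close>.\<close>

lemma ex_code_model:
  fixes B :: "'b cstar_algebra"
  assumes B: "cstar_algebra B" and \<phi>: "cuntz_representation P E p H B \<phi>"
  obtains A :: "'e code cstar_algebra" and \<psi> g where
    "cstar_algebra A" "cuntz_representation P E p H A \<psi>"
    "cstar_generated A (\<psi> ` carrier E) = carrier A"
    "star_hom A B g" "\<And>x. x \<in> carrier E \<Longrightarrow> g (\<psi> x) = \<phi> x"
proof -
  have rep: "representation E p H B \<phi>" using \<phi> by (simp add: cuntz_representation_def)
  interpret B: cstar_algebra B by fact
  interpret product_system_rep P E p H B \<phi> by unfold_locales fact
  define T where "T = cstar_generated B (\<phi> ` carrier E)"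
  have S: "\<phi> ` carrier E \<subseteq> carrier B" by auto
  have T: "cstar_subalgebra B T" "\<phi> ` carrier E \<subseteq> T"
    unfolding T_def using cstar_subalgebra_generated[OF B S] cstar_generated_subset by this+
  obtain c :: "'b \<Rightarrow> 'e code" where c: "inj_on c T"
    using ex_code by (auto simp: T_def)
  define A where "A = transport B T c"
  define g where "g = the_inv_into T c"
  note A = transport[OF B T(1) c, folded A_def g_def]
  have g: "g (c x) = x" if "x \<in> T" for x
    using c that by (simp add: g_def the_inv_into_f_f)
  have g\<phi>: "g (c (\<phi> x)) = \<phi> x" if "x \<in> carrier E" for x
    using g T(2) that by blast
  show thesis
  proof
    show "cstar_algebra A" "star_hom A B g" by (rule A)+
    show "cstar_generated A ((\<lambda>x. c (\<phi> x)) ` carrier E) = carrier A"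
      using cstar_generated_transport[OF B S] c by (simp add: A_def T_def image_image)
    show "cuntz_representation P E p H A (\<lambda>x. c (\<phi> x))"
    \<comment> \<open>\<open>g\<close> is injective on \<open>A\<close>, so it separates points by
      itself.\<close>
    proof (rule cuntz_representation_separating[where I = "{()}" and B = "\<lambda>_. B" and \<rho> = "\<lambda>_. g"])
      show "x = y" if "x \<in> carrier A" "y \<in> carrier A" "\<And>i. i \<in> {()} \<Longrightarrow> g x = g y" for x y
        using that A(3) g by auto
      show "c (\<phi> x) \<in> carrier A" if "x \<in> carrier E" for x
        using that T(2) A(3) by auto
      show "cuntz_representation P E p H B (\<lambda>x. g (c (\<phi> x)))"
        by (rule cuntz_representation_cong[OF B \<phi> g\<phi>])
    qed (use A B in auto)
  qed (use g\<phi> in auto)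
qed

lemma ex_universal_cuntz_pair:
  "\<exists>(A :: 'e code cstar_algebra) i.
    cstar_algebra A \<and> cuntz_representation P E p H A i \<and>
    cuntz_universal TYPE('e code) P E p H A i \<and> cstar_generated A (i ` carrier E) = carrier A"
proof -
  \<comment> \<open>On one fixed type the Cuntz representations form a set and can index a product.
    Indexing by pairs keeps different representations in the same algebra apart.\<close>
  define I where "I = {(B :: 'e code cstar_algebra, \<phi>). cstar_algebra B \<and> cuntz_representation P E p H B \<phi>}"
  define C where "C = cstar_prod I fst"
  have cstar: "cstar_algebra (fst k)" and cuntz: "cuntz_representation P E p H (fst k) (snd k)"
    if "k \<in> I" for k
    using that by (auto simp: I_def)
  have C: "cstar_algebra C"
    unfolding C_def by (rule cstar_algebra_cstar_prod) (rule cstar)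
  interpret star_family C I fst "\<lambda>k f. f k"
    unfolding C_def by (rule star_family_cstar_prod) (rule cstar)
  define \<phi> where "\<phi> x = (\<lambda>k\<in>I. snd k x)" for x
  have \<phi>_closed: "\<phi> x \<in> carrier C" if x: "x \<in> carrier E" for x
    unfolding C_def
  proof (rule cstar_prod_carrierI)
    have rep: "representation E p H (fst k) (snd k)" if "k \<in> I" for k
      using cuntz[OF that] by (simp add: cuntz_representation_def)
    show "\<phi> x \<in> (\<Pi>\<^sub>E k\<in>I. carrier (fst k))"
      using representation_closed[OF rep x] by (auto simp: \<phi>_def)
    show "cnorm (fst k) (\<phi> x k) \<le> sqrt (cmod (ip (H (p x)) x x))" if k: "k \<in> I" for k
    proof -
      interpret B: cstar_algebra "fst k" by (rule cstar[OF k])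
      interpret product_system_rep P E p H "fst k" "snd k" by unfold_locales (rule rep[OF k])
      show ?thesis using cnorm_rep_le[OF x] k by (simp add: \<phi>_def)
    qed
  qed
  have \<phi>: "cuntz_representation P E p H C \<phi>"
  proof (rule cuntz_representation_separating[OF C cstar hom separating \<phi>_closed])
    show "cuntz_representation P E p H (fst k) (\<lambda>x. \<phi> x k)" if "k \<in> I" for k
      using cuntz[OF that] that by (simp add: \<phi>_def)
  qed
  \<comment> \<open>The product lives on a type of functions; the subalgebra generated by the image
    of \<open>\<phi>\<close> is brought back to the type of codes.\<close>
  obtain A :: "'e code cstar_algebra" and \<psi> g where
    A: "cstar_algebra A" "cuntz_representation P E p H A \<psi>"
      "cstar_generated A (\<psi> ` carrier E) = carrier A"
    and g: "star_hom A C g" "\<And>x. x \<in> carrier E \<Longrightarrow> g (\<psi> x) = \<phi> x"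
    using ex_code_model[OF C \<phi>] by blast
  have "cuntz_universal TYPE('e code) P E p H A \<psi>"
    unfolding cuntz_universal_def
  proof (intro allI impI)
    fix B :: "'e code cstar_algebra" and \<theta>
    assume "cstar_algebra B" "cuntz_representation P E p H B \<theta>"
    then have k: "(B, \<theta>) \<in> I" by (simp add: I_def)
    \<comment> \<open>The required map is the coordinate of \<open>g\<close> at the index
      \<open>(B, \<theta>)\<close>.\<close>
    have "star_hom A B (\<lambda>a. g a (B, \<theta>))"
      using star_hom_comp[OF g(1) hom[OF k]] by simp
    moreover have "\<forall>x\<in>carrier E. g (\<psi> x) (B, \<theta>) = \<theta> x"
      using g(2) k by (simp add: \<phi>_def)
    ultimately show "\<exists>h. star_hom A B h \<and> (\<forall>x\<in>carrier E. h (\<psi> x) = \<theta> x)"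
      by blast
  qed
  with A show ?thesis by blast
qed

text \<open>A representation on another type has a code model. The hypothesis maps \<open>A\<close>
  to that model, whose decoding map leads on to \<open>B\<close>.\<close>

lemma cuntz_universal_any_type:
  assumes "cuntz_universal TYPE('e code) P E p H A i"
  shows "cuntz_universal TYPE('b) P E p H A i"
  unfolding cuntz_universal_def
proof (intro allI impI)
  fix B :: "'b cstar_algebra" and \<phi>
  assume B: "cstar_algebra B" and \<phi>: "cuntz_representation P E p H B \<phi>"
  obtain C :: "'e code cstar_algebra" and \<psi> g where
    C: "cstar_algebra C" "cuntz_representation P E p H C \<psi>"
    and g: "star_hom C B g" "\<And>x. x \<in> carrier E \<Longrightarrow> g (\<psi> x) = \<phi> x"
    using ex_code_model[OF B \<phi>] by metis
  obtain h where h: "star_hom A C h" "\<forall>x\<in>carrier E. h (i x) = \<psi> x"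
    using assms C unfolding cuntz_universal_def by blast
  have "star_hom A B (\<lambda>a. g (h a))" by (rule star_hom_comp[OF h(1) g(1)])
  moreover have "\<forall>x\<in>carrier E. g (h (i x)) = \<phi> x" using h(2) g(2) by simp
  ultimately show "\<exists>h. star_hom A B h \<and> (\<forall>x\<in>carrier E. h (i x) = \<phi> x)"
    by (intro exI[of _ "\<lambda>a. g (h a)"]) simp
qed

text \<open>Each pair maps to the other by universality, and the composites fix the generators, so
  they are identities by \<open>star_hom_eq_on_generated\<close>. Since \<open>B\<close> may have
  any type, \<open>A\<close> is first made universal for that type.\<close>

lemma cuntz_universal_unique:
  fixes A :: "'e code cstar_algebra" and B :: "'c cstar_algebra"
  assumes A: "cstar_algebra A" "cuntz_representation P E p H A i"
      "cuntz_universal TYPE('e code) P E p H A i" "cstar_generated A (i ` carrier E) = carrier A"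
    and B: "cstar_algebra B" "cuntz_representation P E p H B j"
      "cuntz_universal TYPE('e code) P E p H B j" "cstar_generated B (j ` carrier E) = carrier B"
  shows "\<exists>\<theta>. star_iso A B \<theta> \<and> (\<forall>x\<in>carrier E. \<theta> (i x) = j x)"
proof -
  obtain \<theta> where \<theta>: "star_hom A B \<theta>" "\<forall>x\<in>carrier E. \<theta> (i x) = j x"
    using cuntz_universal_any_type[OF A(3), where 'b = 'c] B(1,2) unfolding cuntz_universal_def by blast
  obtain \<eta> where \<eta>: "star_hom B A \<eta>" "\<forall>x\<in>carrier E. \<eta> (j x) = i x"
    using B(3) A(1,2) unfolding cuntz_universal_def by blast
  have "\<eta> (\<theta> x) = x" if "x \<in> carrier A" for x
    by (rule star_hom_eq_on_generated[OF A(1) A(1) star_hom_comp[OF \<theta>(1) \<eta>(1)] star_hom_id A(4)])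
      (use \<theta>(2) \<eta>(2) that in auto)
  moreover have "\<theta> (\<eta> x) = x" if "x \<in> carrier B" for x
    by (rule star_hom_eq_on_generated[OF B(1) B(1) star_hom_comp[OF \<eta>(1) \<theta>(1)] star_hom_id B(4)])
      (use \<theta>(2) \<eta>(2) that in auto)
  ultimately have "bij_betw \<theta> (carrier A) (carrier B)"
    using star_hom_closed[OF \<theta>(1)] star_hom_closed[OF \<eta>(1)]
    by (intro bij_betw_byWitness[where f' = \<eta>]) auto
  with \<theta> show ?thesis unfolding star_iso_def by blast
qed

end

theorem proposition1p1:
  fixes P :: "'p monoid" and E :: "'e monoid" and p :: "'e \<Rightarrow> 'p"
    and H :: "'p \<Rightarrow> 'e hilbert_space"
  assumes "fin_dim_product_system P E p H"
  shows "let O_E = cuntz_algebra P E p H; i_E = cuntz_map P E p H in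
      cstar_algebra O_E \<and> cuntz_representation P E p H O_E i_E \<and>
      cuntz_universal TYPE('b) P E p H O_E i_E \<and>
      cstar_generated O_E (i_E ` carrier E) = carrier O_E \<and>
      (\<forall>(A :: 'c cstar_algebra) j.
        cstar_algebra A \<and> cuntz_representation P E p H A j \<and>
        cuntz_universal TYPE('e code) P E p H A j \<and>
        cstar_generated A (j ` carrier E) = carrier A \<longrightarrow>
        (\<exists>\<theta>. star_iso O_E A \<theta> \<and> (\<forall>x\<in>carrier E. \<theta> (i_E x) = j x)))"
proof -
  interpret fin_dim_product_system P E p H by fact
  define O_E i_E where "O_E = cuntz_algebra P E p H" and "i_E = cuntz_map P E p H"
  let ?good = "\<lambda>(A :: 'e code cstar_algebra, i). cstar_algebra A \<and> cuntz_representation P E p H A i \<and>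
    cuntz_universal TYPE('e code) P E p H A i \<and> cstar_generated A (i ` carrier E) = carrier A"
  \<comment> \<open>This makes the choice behind \<open>cuntz_pair\<close> succeed. It concerns
    tests on the type of codes; other types follow by
    \<open>cuntz_universal_any_type\<close>.\<close>
  have "\<exists>x. ?good x" using ex_universal_cuntz_pair by auto
  then have "?good (cuntz_pair P E p H)"
    unfolding cuntz_pair_def by (rule someI_ex)
  then have good: "cstar_algebra O_E" "cuntz_representation P E p H O_E i_E"
    "cuntz_universal TYPE('e code) P E p H O_E i_E" "cstar_generated O_E (i_E ` carrier E) = carrier O_E"
    by (auto simp: O_E_def i_E_def cuntz_algebra_def cuntz_map_def case_prod_beta)
  show ?thesis
    unfolding Let_def O_E_def[symmetric] i_E_def[symmetric]
    using good cuntz_universal_any_type[OF good(3)] cuntz_universal_unique[OF good] by blast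
qed

end
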